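(* Let $f$ be a non-constant entire function of order zero. Then, given $\varepsilon>0$, there exist arbitrarily large values $r$ such that for every sector $S$ of opening $\alpha$ (the same $r$ serving all sectors simultaneously), \[ \frac{\alpha-\varepsilon}{2\pi}\ \le\ A(r,S,f)\ \le\ \frac{\alpha+\varepsilon}{2\pi}. \]
   Context: A sector is a set $S=\{w\in\mathbb{C}: 0<|w|<\infty,\ \theta_1<\arg w<\theta_2\}$ with vertex at the origin; its opening is $\alpha=\theta_2-\theta_1\in(0,2\pi]$. For an entire function $f$, write $r\mathbb{D}=\{z\in\mathbb{C}:|z|<r\}$ and define the relative area of the preimage \[ A(r,S,f)=\frac{\operatorname{Area}(f^{-1}S\cap r\mathbb{D})}{\operatorname{Area}(r\mathbb{D})}. \] Entire functions are assumed non-constant. The order of an entire function $f$ is $\rho=\limsup_{r\to\infty}\frac{\log\log M(r,f)}{\log r}$, where $M(r,f)=\max_{|z|\le r}|f(z)|$. *)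

theory Defs
  imports "HOL-Complex_Analysis.Complex_Analysis"
begin

text \<open>
  The argument is multivalued, so \<open>w\<close> belongs to the sector if some argument of \<open>w\<close> lies in
  \<open>(\<theta>\<^sub>1, \<theta>\<^sub>2)\<close>; a sector of opening \<open>2 * pi\<close> is then a plane slit along a closed ray. Since
  \<open>is_Arg 0 \<theta>\<close> holds for every \<open>\<theta>\<close>, the vertex is excluded separately.
\<close>
definition sector :: "real \<Rightarrow> real \<Rightarrow> complex set" where
  "sector \<theta>\<^sub>1 \<theta>\<^sub>2 = {w. w \<noteq> 0 \<and> (\<exists>\<theta>. is_Arg w \<theta> \<and> \<theta>\<^sub>1 < \<theta> \<and> \<theta> < \<theta>\<^sub>2)}"

definition relative_area :: "real \<Rightarrow> complex set \<Rightarrow> (complex \<Rightarrow> complex) \<Rightarrow> real" where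
  "relative_area r S f = measure lebesgue (f -` S \<inter> ball 0 r) / measure lebesgue (ball (0::complex) r)"

text \<open>For continuous \<open>f\<close> and \<open>r \<ge> 0\<close> the supremum is attained, so it is the maximum.\<close>
definition max_modulus :: "real \<Rightarrow> (complex \<Rightarrow> complex) \<Rightarrow> real" where
  "max_modulus r f = (SUP z\<in>cball 0 r. norm (f z))"

text \<open>
  For non-constant entire \<open>f\<close> the maximum modulus tends to infinity, so the iterated logarithm is
  a genuine one for all large \<open>r\<close>, and only these matter for the upper limit. Extended real
  values accommodate functions of infinite order.
\<close>
definition entire_order :: "(complex \<Rightarrow> complex) \<Rightarrow> ereal" where
  "entire_order f = Limsup at_top (\<lambda>r::real. ereal (ln (ln (max_modulus r f)) / ln r))"

end

theory Submission
  imports Defs "HOL-Real_Asymp.Real_Asymp"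
begin

text \<open>
  Put \<open>F z = z f'(z) / f(z)\<close>, so that \<open>Re F\<close> is the speed at which \<open>arg f\<close> turns along a circle about
  the origin. For a sector \<open>S\<close> of opening \<open>\<alpha>\<close> let \<open>g\<close> be the indicator function of \<open>f -` S\<close> minus
  \<open>\<alpha> / (2 \<pi>)\<close>. On a zero-free circle \<open>Re F * g\<close> is the derivative of a periodic function of the angle,
  so its integral vanishes, and hence so does its integral over every disc \<open>D\<close>. For every \<open>N\<close> the
  integral of \<open>N * g\<close> over \<open>D\<close> is therefore bounded by the integral of \<open>|F - N|\<close>, whatever the sector.
  Take for \<open>N\<close> the number of zeros in \<open>D\<close>. Since \<open>F\<close> is the sum of \<open>z / (z - a)\<close> over the zeros \<open>a\<close>,
  the integral of \<open>|F - N|\<close> is at most of order \<open>r\<^sup>2\<close> times the sum of \<open>min (|a| / r) (r / |a|)\<close>.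
  As the counting function of the zeros grows slower than any power, that sum is \<open>o(N)\<close> along a
  sequence of radii placed a little beyond points where the counting function, divided by a
  small power of the radius, is maximal.
\<close>

subsection \<open>Areas in the plane\<close>

text \<open>A measure with the right value on every box is Lebesgue measure, and planar boxes are
  products of intervals. This gives access to iterated integrals in either order.\<close>

lemma lborel_complex_eq:
  "(lborel :: complex measure) = distr (lborel \<Otimes>\<^sub>M lborel) borel (\<lambda>(x, y). Complex x y)"
proof (rule lborel_eqI)
  fix l u :: complex
  assume *: "\<And>b. b \<in> Basis \<Longrightarrow> l \<bullet> b \<le> u \<bullet> b"
  have le: "Re l \<le> Re u" "Im l \<le> Im u"
    using *[of 1] *[of \<i>] by (auto simp: Basis_complex_def)
  have m: "(\<lambda>(x, y). Complex x y) \<in> borel_measurable (lborel \<Otimes>\<^sub>M lborel)"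
    unfolding complex_eq_iff Complex_eq case_prod_beta by measurable
  have "(\<lambda>(x, y). Complex x y) -` box l u \<inter> space (lborel \<Otimes>\<^sub>M lborel)
      = box (Re l) (Re u) \<times> box (Im l) (Im u)"
    by (auto simp: in_box_complex_iff space_pair_measure)
  then show "emeasure (distr (lborel \<Otimes>\<^sub>M lborel) borel (\<lambda>(x, y). Complex x y)) (box l u)
      = ennreal (\<Prod>b\<in>Basis. (u - l) \<bullet> b)"
    using le m
    by (simp add: emeasure_distr lborel.emeasure_pair_measure_Times Basis_complex_def
        flip: ennreal_mult)
qed simp

lemma nn_integral_lborel_complex:
  assumes [measurable]: "g \<in> borel_measurable borel"
  shows "(\<integral>\<^sup>+z. g z \<partial>(lborel :: complex measure)) = (\<integral>\<^sup>+y. \<integral>\<^sup>+x. g (Complex x y) \<partial>lborel \<partial>lborel)"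
    and "(\<integral>\<^sup>+z. g z \<partial>(lborel :: complex measure)) = (\<integral>\<^sup>+x. \<integral>\<^sup>+y. g (Complex x y) \<partial>lborel \<partial>lborel)"
proof -
  have m [measurable]: "(\<lambda>(x, y). Complex x y) \<in> borel_measurable (lborel \<Otimes>\<^sub>M lborel)"
    unfolding complex_eq_iff Complex_eq case_prod_beta by measurable
  have m2: "(\<lambda>z. g (case z of (x, y) \<Rightarrow> Complex x y)) \<in> borel_measurable (lborel \<Otimes>\<^sub>M lborel)"
    by measurable
  have eq: "(\<integral>\<^sup>+z. g z \<partial>(lborel :: complex measure)) = (\<integral>\<^sup>+z. g (case z of (x, y) \<Rightarrow> Complex x y) \<partial>(lborel \<Otimes>\<^sub>M lborel))"
    by (subst lborel_complex_eq) (rule nn_integral_distr, simp_all)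
  show "(\<integral>\<^sup>+z. g z \<partial>(lborel :: complex measure)) = (\<integral>\<^sup>+y. \<integral>\<^sup>+x. g (Complex x y) \<partial>lborel \<partial>lborel)"
    unfolding eq using lborel_pair.nn_integral_snd[OF m2] by simp
  show "(\<integral>\<^sup>+z. g z \<partial>(lborel :: complex measure)) = (\<integral>\<^sup>+x. \<integral>\<^sup>+y. g (Complex x y) \<partial>lborel \<partial>lborel)"
    unfolding eq using lborel.nn_integral_fst[OF m2] by simp
qed

section \<open>Rotation invariance of planar Lebesgue measure\<close>

lemma nn_integral_lborel_translate:
  assumes [measurable]: "g \<in> borel_measurable borel"
  shows "(\<integral>\<^sup>+x. g (x + t) \<partial>lborel) = (\<integral>\<^sup>+x. g x \<partial>(lborel :: real measure))"
proof -
  have "(\<integral>\<^sup>+x. g (t + x) \<partial>lborel) = (\<integral>\<^sup>+x. g x \<partial>distr lborel borel ((+) t))"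
    by (subst nn_integral_distr) auto
  then show ?thesis by (simp add: lborel_distr_plus add.commute)
qed

text \<open>For a fixed value of the coordinate that a shear preserves, the other one is merely
  translated. Integrating first over the moving coordinate reduces the claim to translation
  invariance on the line.\<close>

lemma lborel_complex_shear:
  "distr lborel borel (\<lambda>z::complex. z + of_real (a * Im z)) = lborel" (is "distr _ _ ?T = _")
  "distr lborel borel (\<lambda>z::complex. z + \<i> * of_real (a * Re z)) = lborel" (is "distr _ _ ?U = _")
proof -
  have *: "distr lborel borel h = (lborel :: complex measure)"
    if [measurable]: "h \<in> borel_measurable borel"
      and "\<And>g. g \<in> borel_measurable borel \<Longrightarrow> (\<integral>\<^sup>+z. g (h z) \<partial>lborel) = (\<integral>\<^sup>+z. g z \<partial>lborel)" for h
  proof (rule measure_eqI)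
    fix A assume "A \<in> sets (distr lborel borel h)"
    then have [measurable]: "A \<in> sets borel" by simp
    have "emeasure (distr lborel borel h) A = (\<integral>\<^sup>+z. indicator A z \<partial>distr lborel borel h)"
      by simp
    also have "\<dots> = (\<integral>\<^sup>+z. indicator A (h z) \<partial>lborel)"
      by (subst nn_integral_distr) auto
    also have "\<dots> = (\<integral>\<^sup>+z. indicator A z \<partial>lborel)"
      by (rule that(2)) auto
    finally show "emeasure (distr lborel borel h) A = emeasure lborel A" by simp
  qed simp
  have [measurable]: "?T \<in> borel_measurable borel" "?U \<in> borel_measurable borel"
    by measurable
  show "distr lborel borel ?T = lborel"
  proof (rule *)
    fix g :: "complex \<Rightarrow> ennreal" assume [measurable]: "g \<in> borel_measurable borel"
    have [measurable]: "(\<lambda>x. g (Complex x y)) \<in> borel_measurable borel" for y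
      unfolding Complex_eq by measurable
    have "(\<integral>\<^sup>+z. g (?T z) \<partial>lborel) = (\<integral>\<^sup>+y. \<integral>\<^sup>+x. g (Complex (x + a * y) y) \<partial>lborel \<partial>lborel)"
      by (subst nn_integral_lborel_complex(1)) (auto simp: Complex_eq algebra_simps intro!: nn_integral_cong)
    then show "(\<integral>\<^sup>+z. g (?T z) \<partial>lborel) = (\<integral>\<^sup>+z. g z \<partial>lborel)"
      by (simp add: nn_integral_lborel_complex(1) nn_integral_lborel_translate[of "\<lambda>x. g (Complex x _)"])
  qed simp
  show "distr lborel borel ?U = lborel"
  proof (rule *)
    fix g :: "complex \<Rightarrow> ennreal" assume [measurable]: "g \<in> borel_measurable borel"
    have [measurable]: "(\<lambda>y. g (Complex x y)) \<in> borel_measurable borel" for x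
      unfolding Complex_eq by measurable
    have "(\<integral>\<^sup>+z. g (?U z) \<partial>lborel) = (\<integral>\<^sup>+x. \<integral>\<^sup>+y. g (Complex x (y + a * x)) \<partial>lborel \<partial>lborel)"
      by (subst nn_integral_lborel_complex(2)) (auto simp: Complex_eq algebra_simps intro!: nn_integral_cong)
    then show "(\<integral>\<^sup>+z. g (?U z) \<partial>lborel) = (\<integral>\<^sup>+z. g z \<partial>lborel)"
      by (simp add: nn_integral_lborel_complex(2) nn_integral_lborel_translate[of "\<lambda>y. g (Complex _ y)"])
  qed simp
qed

text \<open>A rotation by an angle other than \<open>0\<close> and \<open>\<pi>\<close> is a product of three shears.\<close>
lemma lborel_complex_rotate_nonreal:
  assumes "norm c = 1" "Im c \<noteq> 0"
  shows "distr lborel borel ((*) c) = (lborel :: complex measure)"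
proof -
  \<comment> \<open>For \<open>c = cis t\<close> this is \<open>- tan (t / 2)\<close>: the rotation
    is a horizontal, a vertical and again a horizontal shear, with coefficients \<open>a\<close>,
    \<open>Im c\<close>, \<open>a\<close>.\<close>
  define a where "a = (Re c - 1) / Im c"
  define T where "T = (\<lambda>z::complex. z + of_real (a * Im z))"
  define U where "U = (\<lambda>z::complex. z + \<i> * of_real (Im c * Re z))"
  have [measurable]: "T \<in> borel_measurable borel" "U \<in> borel_measurable borel"
    unfolding T_def U_def by measurable
  have 1: "(Re c)\<^sup>2 + (Im c)\<^sup>2 = 1"
    using assms cmod_power2[of c] by simp
  have 2: "a * Im c = Re c - 1" using assms(2) by (simp add: a_def)
  have "(a * (Re c + 1) + Im c) * Im c = 0"
    using 1 2 by algebra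
  then have 3: "a * (Re c + 1) = - Im c"
    using assms(2) by auto
  have "c * z = T (U (T z))" for z
    unfolding T_def U_def complex_eq_iff using 2 3
    by simp algebra
  then have "(*) c = T \<circ> (U \<circ> T)" by auto
  then have "distr lborel borel ((*) c) = distr (distr (distr lborel borel T) borel U) borel T"
    by (subst distr_distr, simp, simp, subst distr_distr) (auto simp: o_assoc)
  then show ?thesis
    using lborel_complex_shear unfolding T_def U_def by simp
qed

lemma lborel_complex_rotate:
  assumes "norm c = 1"
  shows "distr lborel borel ((*) c) = (lborel :: complex measure)"
proof (cases "Im c = 0")
  case True
  then have "c = 1 \<or> c = -1"
    using assms by (auto simp: complex_eq_iff cmod_def abs_if split: if_splits)
  \<comment> \<open>For the half turn \<open>Im c\<close> vanishes, so it is composed of two quarter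
    turns.\<close>
  moreover have "distr lborel borel ((*) (-1)) = (lborel :: complex measure)"
  proof -
    have "(*) (-1) = (*) \<i> \<circ> (*) \<i>" by (auto simp flip: mult.assoc)
    then have "distr lborel borel ((*) (-1)) = distr (distr lborel borel ((*) \<i>)) borel ((*) \<i>)"
      by (subst distr_distr) auto
    then show ?thesis by (simp add: lborel_complex_rotate_nonreal)
  qed
  moreover have "distr lborel borel ((*) 1) = (lborel :: complex measure)"
    by (rule measure_eqI) (auto simp: emeasure_distr vimage_def)
  ultimately show ?thesis by blast
qed (use assms lborel_complex_rotate_nonreal in blast)


section \<open>Discs and the integral of the inverse distance\<close>

lemma measure_lborel_disc: "r \<ge> 0 \<Longrightarrow> measure lborel (ball (c :: complex) r) = pi * r\<^sup>2"
  and emeasure_lborel_disc: "r \<ge> 0 \<Longrightarrow> emeasure lborel (ball (c :: complex) r) = ennreal (pi * r\<^sup>2)"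
  and emeasure_lborel_cdisc: "r \<ge> 0 \<Longrightarrow> emeasure lborel (cball (c :: complex) r) = ennreal (pi * r\<^sup>2)"
  using content_ball[of r c] emeasure_ball[of r c] emeasure_cball[of r c]
  by (simp_all add: unit_ball_vol_2 measure_def)

text \<open>On the shell \<open>r / 2^(k + 1) < dist z a \<le> r / 2^k\<close> the integrand is at most \<open>2^(k + 1) / r\<close>.\<close>
lemma nn_integral_inverse_dist_disc:
  fixes a :: complex
  assumes "r > 0"
  shows "(\<integral>\<^sup>+z. ennreal (1 / dist z a) * indicator (ball 0 r) z \<partial>lborel) \<le> ennreal (5 * pi * r)"
proof -
  define t where "t k z = ennreal (2 ^ Suc k / r) * indicator (cball a (r / 2 ^ k)) z" for k z
  \<comment> \<open>The first summand serves the points at distance at least \<open>r\<close> from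
    \<open>a\<close>, the series the nearer ones. At \<open>z = a\<close> the left side is zero
    because \<open>1 / 0 = 0\<close>.\<close>
  have "ennreal (1 / dist z a) * indicator (ball 0 r) z
      \<le> ennreal (1 / r) * indicator (ball 0 r) z + (\<Sum>k. t k z)" for z
  proof -
    consider "z = a" | "dist z a \<ge> r" | "z \<noteq> a" "dist z a < r" by linarith
    then show ?thesis
    proof cases
      case 2
      then have "1 / dist z a \<le> 1 / r" using assms by (intro frac_le) auto
      then show ?thesis by (auto simp: indicator_def ennreal_leI intro!: add_increasing2)
    next
      case 3
      obtain n where "(1 / 2) ^ n < dist z a / r"
        using real_arch_pow_inv[of "dist z a / r" "1 / 2"] assms 3(1) by auto
      then have "r / 2 ^ n < dist z a"
        using assms by (simp add: field_simps)
      moreover have "r / 2 ^ Suc n \<le> r / 2 ^ n" using assms by (simp add: field_simps)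
      ultimately have "\<exists>k. r / 2 ^ Suc k < dist z a" by (blast intro: le_less_trans)
      \<comment> \<open>Minimality puts \<open>z\<close> into the disc of radius
        \<open>r / 2 ^ k\<close>; for \<open>k = 0\<close> the case assumption does.\<close>
      define k where "k = (LEAST k. r / 2 ^ Suc k < dist z a)"
      have k: "r / 2 ^ Suc k < dist z a"
        unfolding k_def using \<open>\<exists>k. _ < _\<close> by (rule LeastI_ex)
      have "dist z a \<le> r / 2 ^ k"
      proof (cases k)
        case (Suc j)
        then have "\<not> r / 2 ^ Suc j < dist z a" unfolding k_def by (metis lessI not_less_Least)
        then show ?thesis using Suc by simp
      qed (use 3 in simp)
      then have "t k z = ennreal (2 ^ Suc k / r)" by (simp add: t_def dist_commute)
      moreover have "1 / dist z a \<le> 2 ^ Suc k / r"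
        using k assms 3(1) by (simp add: field_simps)
      ultimately have "ennreal (1 / dist z a) \<le> t k z" by (simp add: ennreal_leI del: power_Suc)
      also have "\<dots> \<le> (\<Sum>k. t k z)"
        using sum_le_suminf[of "\<lambda>k. t k z" "{k}"] by simp
      finally show ?thesis
        by (auto simp: indicator_def intro: add_increasing)
    qed (auto)
  qed
  then have "(\<integral>\<^sup>+z. ennreal (1 / dist z a) * indicator (ball 0 r) z \<partial>lborel)
      \<le> (\<integral>\<^sup>+z. ennreal (1 / r) * indicator (ball 0 r) z + (\<Sum>k. t k z) \<partial>lborel)"
    by (intro nn_integral_mono) simp
  also have "\<dots> = ennreal (1 / r) * emeasure lborel (ball (0::complex) r)
      + (\<Sum>k. ennreal (2 ^ Suc k / r) * emeasure lborel (cball a (r / 2 ^ k)))"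
  proof -
    have [measurable]: "t k \<in> borel_measurable borel" for k
      unfolding t_def by (intro borel_measurable_times_ennreal borel_measurable_indicator) auto
    have [measurable]: "(\<lambda>z. ennreal (1 / r) * indicator (ball (0::complex) r) z) \<in> borel_measurable borel"
      by (intro borel_measurable_times_ennreal borel_measurable_indicator) auto
    have "(\<integral>\<^sup>+z. t k z \<partial>lborel) = ennreal (2 ^ Suc k / r) * emeasure lborel (cball a (r / 2 ^ k))" for k
      unfolding t_def by (simp add: nn_integral_cmult_indicator)
    then show ?thesis
      by (simp add: nn_integral_add nn_integral_suminf nn_integral_cmult_indicator)
  qed
  \<comment> \<open>From one \<open>k\<close> to the next the disc area shrinks by the factor 4
    while the bound doubles, so the series is geometric with sum \<open>4 * pi * r\<close>.\<close>
  also have "\<dots> = ennreal (pi * r) + (\<Sum>k. ennreal (2 * pi * r * (1 / 2) ^ k))"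
    using assms
    by (simp add: emeasure_lborel_disc emeasure_lborel_cdisc field_simps power2_eq_square
        power_mult_distrib power_divide flip: ennreal_mult)
  also have "(\<Sum>k. ennreal (2 * pi * r * (1 / 2) ^ k)) = ennreal (4 * pi * r)"
    using assms sums_mult[OF geometric_sums[of "1/2::real"], of "2 * pi * r"]
    by (intro sums_unique[symmetric] sums_ennreal[THEN iffD2]) (auto simp: mult.assoc)
  also have "ennreal (pi * r) + ennreal (4 * pi * r) = ennreal (5 * pi * r)"
    using assms by (simp flip: ennreal_plus)
  finally show ?thesis .
qed

text \<open>In the plane a simple pole is integrable, with a bound independent of its position; this
  permits treating the poles of \<open>f' / f\<close> one by one.\<close>

lemma integrable_inverse_dist_disc:
  fixes a :: complex
  assumes "r > 0"
  shows "integrable lborel (\<lambda>z. indicator (ball 0 r) z / dist z a)"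
    and "(\<integral>z. indicator (ball 0 r) z / dist z a \<partial>lborel) \<le> 5 * pi * r"
proof -
  have eq: "(\<integral>\<^sup>+z. ennreal (indicator (ball 0 r) z / dist z a) \<partial>lborel)
      = (\<integral>\<^sup>+z. ennreal (1 / dist z a) * indicator (ball 0 r) z \<partial>lborel)"
    by (intro nn_integral_cong) (auto simp: indicator_def)
  have le: "(\<integral>\<^sup>+z. ennreal (indicator (ball 0 r) z / dist z a) \<partial>lborel) \<le> ennreal (5 * pi * r)"
    unfolding eq by (rule nn_integral_inverse_dist_disc) fact
  show "integrable lborel (\<lambda>z. indicator (ball 0 r) z / dist z a)"
    using le by (intro integrableI_nonneg borel_measurable_divide borel_measurable_indicator
        borel_measurable_continuous_onI continuous_intros)
      (auto simp: le_less_trans)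
  then show "(\<integral>z. indicator (ball 0 r) z / dist z a \<partial>lborel) \<le> 5 * pi * r"
    using le assms by (subst integral_eq_nn_integral) (auto intro!: enn2real_leI)
qed

text \<open>Rotations preserve area, so the area integral equals its average over all rotations;
  exchanging the order of integration turns this average into integrals over circles.\<close>

lemma integral_eq_0_if_circle_integrals_eq_0:
  fixes \<Phi> :: "complex \<Rightarrow> real"
  assumes int: "integrable lborel \<Phi>"
    and circ: "AE z in lborel. ((\<lambda>\<theta>. \<Phi> (cis \<theta> * z)) has_integral 0) {0..2 * pi}"
  shows "(\<integral>z. \<Phi> z \<partial>lborel) = 0"
proof -
  have [measurable]: "\<Phi> \<in> borel_measurable borel" using int by auto
  define F where "F = (\<lambda>(\<theta>::real, z). indicator {0..2 * pi} \<theta> * \<Phi> (cis \<theta> * z))"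
  have [measurable]: "(\<lambda>z. cis (fst z) * snd z) \<in> borel_measurable (borel \<Otimes>\<^sub>M (borel :: complex measure))"
    unfolding borel_prod by (intro borel_measurable_continuous_onI continuous_intros)
  have Fm [measurable]: "F \<in> borel_measurable (lborel \<Otimes>\<^sub>M lborel)"
    unfolding F_def case_prod_beta by measurable
  have rot: "integrable lborel (\<lambda>z. h (cis \<theta> * z)) \<and> (\<integral>z. h (cis \<theta> * z) \<partial>lborel) = (\<integral>z. h z \<partial>lborel)"
    if h: "integrable lborel h" for h :: "complex \<Rightarrow> real" and \<theta>
  proof -
    have hm [measurable]: "h \<in> borel_measurable borel" using h by auto
    have "integrable (distr lborel borel ((*) (cis \<theta>))) h"
      using h by (simp add: lborel_complex_rotate)
    then have "integrable lborel (\<lambda>z. h (cis \<theta> * z))"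
      by (subst (asm) integrable_distr_eq) auto
    moreover have "(\<integral>z. h z \<partial>distr lborel borel ((*) (cis \<theta>))) = (\<integral>z. h (cis \<theta> * z) \<partial>lborel)"
      by (subst integral_distr) auto
    ultimately show ?thesis by (simp add: lborel_complex_rotate)
  qed
  have 1: "(\<integral>z. norm (F (\<theta>, z)) \<partial>lborel) = indicator {0..2 * pi} \<theta> * (\<integral>z. norm (\<Phi> z) \<partial>lborel)" for \<theta>
    using rot[of "\<lambda>z. norm (\<Phi> z)" \<theta>] int by (simp add: F_def abs_mult)
  have 2: "(\<integral>z. F (\<theta>, z) \<partial>lborel) = indicator {0..2 * pi} \<theta> * (\<integral>z. \<Phi> z \<partial>lborel)" for \<theta>
    using rot[of "\<Phi>" \<theta>] int by (simp add: F_def)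
  have intF: "integrable (lborel \<Otimes>\<^sub>M lborel) F"
  proof (rule lborel_pair.Fubini_integrable[OF Fm])
    show "integrable lborel (\<lambda>\<theta>. \<integral>z. norm (F (\<theta>, z)) \<partial>lborel)"
      unfolding 1 by (intro integrable_mult_left integrable_real_indicator) auto
    show "AE \<theta> in lborel. integrable lborel (\<lambda>z. F (\<theta>, z))"
      using rot[OF int] by (auto simp: F_def)
  qed
  have "2 * pi * (\<integral>z. \<Phi> z \<partial>lborel) = (\<integral>\<theta>. \<integral>z. F (\<theta>, z) \<partial>lborel \<partial>lborel)"
    unfolding 2 by simp
  also have "\<dots> = (\<integral>z. \<integral>\<theta>. F (\<theta>, z) \<partial>lborel \<partial>lborel)"
    using lborel_pair.Fubini_integral[of "\<lambda>x y. F (x, y)"] intF by simp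
  also have "\<dots> = (\<integral>z. 0 \<partial>(lborel :: complex measure))"
  proof (rule integral_cong_AE)
    have "AE z in lborel. integrable lborel (\<lambda>\<theta>. F (\<theta>, z))"
      using lborel_pair.AE_integrable_snd[of "\<lambda>x y. F (x, y)"] intF by simp
    with circ show "AE z in lborel. (\<integral>\<theta>. F (\<theta>, z) \<partial>lborel) = 0"
    proof eventually_elim
      case (elim z)
      \<comment> \<open>The hypothesis concerns the gauge integral. Fubini yields absolute
        integrability for almost every \<open>z\<close>, and there both integrals agree.\<close>
      then have "set_integrable lborel {0..2 * pi} (\<lambda>\<theta>. \<Phi> (cis \<theta> * z))"
        by (simp add: set_integrable_def F_def)
      from set_borel_integral_eq_integral(2)[OF this] elim show ?case
        by (simp add: set_lebesgue_integral_def F_def integral_unique)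
    qed
  qed auto
  finally show ?thesis by simp
qed

subsection \<open>Sectors and circles\<close>

text \<open>After rotation by \<open>- \<beta>\<close> the arguments in question lie in (0,
  \<alpha>), inside the interval [0, 2 \<pi>) on which an argument is unique and equals
  \<open>Arg2pi\<close>.\<close>

lemma sector_iff_Arg2pi:
  assumes "0 < \<alpha>" "\<alpha> \<le> 2 * pi"
  shows "w \<in> sector \<beta> (\<beta> + \<alpha>) \<longleftrightarrow>
    w \<noteq> 0 \<and> 0 < Arg2pi (cis (- \<beta>) * w) \<and> Arg2pi (cis (- \<beta>) * w) < \<alpha>"
proof
  assume w: "w \<in> sector \<beta> (\<beta> + \<alpha>)"
  then obtain \<theta> where \<theta>: "w \<noteq> 0" "is_Arg w \<theta>" "\<beta> < \<theta>" "\<theta> < \<beta> + \<alpha>"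
    by (auto simp: sector_def)
  have w': "w = of_real (norm w) * cis \<theta>"
    using \<theta>(2) by (simp add: is_Arg_def cis_conv_exp)
  have "cis (- \<beta>) * (of_real (norm w) * cis \<theta>) = of_real (norm w) * cis (\<theta> - \<beta>)"
    by (simp add: cis_mult mult.left_commute)
  then have "of_real (norm w) * exp (\<i> * of_real (\<theta> - \<beta>)) = cis (- \<beta>) * w"
    using w' by (simp only: flip: cis_conv_exp)
  then have "Arg2pi (cis (- \<beta>) * w) = \<theta> - \<beta>"
    by (rule Arg2pi_unique) (use \<theta> assms in auto)
  then show "w \<noteq> 0 \<and> 0 < Arg2pi (cis (- \<beta>) * w) \<and> Arg2pi (cis (- \<beta>) * w) < \<alpha>"
    using \<theta> by auto
next
  define A where "A = Arg2pi (cis (- \<beta>) * w)"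
  assume w: "w \<noteq> 0 \<and> 0 < Arg2pi (cis (- \<beta>) * w) \<and> Arg2pi (cis (- \<beta>) * w) < \<alpha>"
  have "cis (- \<beta>) * w = of_real (norm w) * cis A"
    using Arg2pi_eq[of "cis (- \<beta>) * w"] by (simp add: A_def cis_conv_exp norm_mult)
  then have "cis \<beta> * (cis (- \<beta>) * w) = of_real (norm w) * cis (\<beta> + A)"
    by (simp add: cis_mult mult_ac add.commute)
  then have "is_Arg w (\<beta> + A)"
    by (simp add: is_Arg_def cis_mult flip: mult.assoc cis_conv_exp of_real_add)
  then show "w \<in> sector \<beta> (\<beta> + \<alpha>)"
    using w by (auto simp: sector_def A_def intro!: exI[of _ "\<beta> + A"])
qed

lemma sets_sector [measurable]:
  assumes "0 < \<alpha>" "\<alpha> \<le> 2 * pi"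
  shows "sector \<beta> (\<beta> + \<alpha>) \<in> sets borel"
proof -
  have "sector \<beta> (\<beta> + \<alpha>)
      = - {0} \<inter> (*) (cis (- \<beta>)) -` ({z. 0 < Arg2pi z} \<inter> {z. Arg2pi z < \<alpha>})"
    using assms by (auto simp: sector_iff_Arg2pi)
  moreover have "open ({z. 0 < Arg2pi z} \<inter> {z. Arg2pi z < \<alpha>})"
    using assms by (intro open_Arg2pi2pi_less_Int) auto
  then have "open ((*) (cis (- \<beta>)) -` ({z. 0 < Arg2pi z} \<inter> {z. Arg2pi z < \<alpha>}))"
    by (intro open_vimage continuous_intros)
  ultimately show ?thesis by (simp add: borel_open open_Int)
qed

section \<open>Integrals of sector indicators along closed curves\<close>

text \<open>
  A primitive, with respect to the argument, of the indicator function of \<open>0 < Arg2pi w < \<alpha>\<close>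
  minus its mean. As it has mean zero, the primitive is continuous across the positive axis.
\<close>
definition arc_primitive :: "real \<Rightarrow> complex \<Rightarrow> real" where
  "arc_primitive \<alpha> w = min \<alpha> (Arg2pi w) - \<alpha> / (2 * pi) * Arg2pi w"

text \<open>As a function of \<open>Arg2pi w\<close> the primitive vanishes at both ends 0 and 2
  \<pi> and has slopes of modulus at most 1. It is thus bounded by the distance to the nearer end,
  which is at most \<open>\<bar>Arg w\<bar>\<close>.\<close>

lemma arc_primitive_bound:
  assumes "0 \<le> \<alpha>" "\<alpha> \<le> 2 * pi" "w \<noteq> 0"
  shows "\<bar>arc_primitive \<alpha> w\<bar> \<le> \<bar>Arg w\<bar>"
proof -
  define A where "A = Arg2pi w"
  have A: "0 \<le> A" "A < 2 * pi" using Arg2pi[of w] by (auto simp: A_def)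
  have w: "of_real (norm w) * exp (\<i> * of_real (Arg w)) = w"
    using Arg_eq[OF assms(3)] by simp
  have "A = Arg w \<or> A = Arg w + 2 * pi"
  proof (cases "Arg w \<ge> 0")
    case True
    then have "Arg2pi w = Arg w"
      using Arg2pi_unique[OF w] assms Arg_le_pi[of w] pi_gt_zero by (simp del: pi_gt_zero)
    then show ?thesis by (simp add: A_def)
  next
    case False
    have "of_real (norm w) * exp (\<i> * of_real (Arg w + 2 * pi)) = w"
      using w by (simp add: distrib_left exp_add mult_ac)
    then have "Arg2pi w = Arg w + 2 * pi"
      by (rule Arg2pi_unique) (use assms False mpi_less_Arg[of w] in auto)
    then show ?thesis by (simp add: A_def)
  qed
  then have m: "min A (2 * pi - A) \<le> \<bar>Arg w\<bar>" by auto
  have 1: "\<alpha> / (2 * pi) * A \<le> A" "\<alpha> / (2 * pi) * A \<le> \<alpha>"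
    using assms A pi_gt_zero mult_left_mono[of A "2 * pi" \<alpha>] mult_right_mono[of \<alpha> "2 * pi" A]
    by (auto simp: field_simps)
  have 2: "\<alpha> - \<alpha> / (2 * pi) * A \<le> 2 * pi - A"
    using mult_right_mono[of "\<alpha> / (2 * pi)" 1 "2 * pi - A"] assms A by (simp add: field_simps)
  have "0 \<le> \<alpha> / (2 * pi) * A" using assms A by simp
  with m 1 2 show ?thesis
    unfolding arc_primitive_def A_def[symmetric] by linarith
qed

text \<open>\<open>Arg2pi\<close> jumps across the positive axis, but there the primitive is
  dominated by \<open>Arg\<close>, which is continuous and zero on that axis.\<close>

lemma continuous_at_arc_primitive:
  assumes "0 \<le> \<alpha>" "\<alpha> \<le> 2 * pi" "w \<noteq> 0"
  shows "isCont (arc_primitive \<alpha>) w"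
proof (cases "w \<in> \<real>\<^sub>\<ge>\<^sub>0")
  case False
  then show ?thesis
    unfolding arc_primitive_def by (intro continuous_intros continuous_at_Arg2pi)
next
  case True
  then have "Arg w = 0" "Arg2pi w = 0" "w \<notin> \<real>\<^sub>\<le>\<^sub>0"
    using assms(3) by (auto simp: nonneg_Reals_def Arg2pi_of_real Arg_of_real)
  then have "isCont Arg w" by (intro continuous_at_Arg)
  then have "(Arg \<longlongrightarrow> 0) (at w)" using \<open>Arg w = 0\<close> by (simp add: isCont_def)
  then have "((\<lambda>v. \<bar>Arg v\<bar>) \<longlongrightarrow> 0) (at w)" by (rule tendsto_rabs_zero)
  moreover have "\<forall>\<^sub>F v in at w. norm (arc_primitive \<alpha> v) \<le> \<bar>Arg v\<bar>"
    using eventually_neq_at_within[of 0 w UNIV]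
    by eventually_elim (use arc_primitive_bound assms in auto)
  ultimately have "(arc_primitive \<alpha> \<longlongrightarrow> 0) (at w)"
    by (rule Lim_null_comparison[rotated])
  then show ?thesis
    using assms \<open>Arg2pi w = 0\<close> by (simp add: isCont_def arc_primitive_def)
qed

text \<open>On the real axis, the imaginary part of \<open>H\<close> is up to a constant factor the
  entire function \<open>E\<close>, so the identity theorem applies. This will show that a curve
  crosses a line through the origin only finitely often unless it stays on it.\<close>

lemma finite_real_zeros_of_imag_part:
  assumes "H holomorphic_on UNIV"
  shows "finite {\<theta> \<in> {a..b}. Im (H (of_real \<theta>)) = 0} \<or> (\<forall>\<theta>. Im (H (of_real \<theta>)) = 0)"
proof -
  define E where "E s = H s - (cnj \<circ> H \<circ> cnj) s" for s
  have E: "E (of_real \<theta>) = 2 * \<i> * of_real (Im (H (of_real \<theta>)))" for \<theta>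
    by (simp add: E_def complex_diff_cnj mult_ac)
  have hol: "E holomorphic_on UNIV"
    unfolding E_def using assms
    by (intro holomorphic_intros holomorphic_on_compose_cnj_cnj) auto
  define Z where "Z = {\<theta> \<in> {a..b}. Im (H (of_real \<theta>)) = 0}"
  have sub: "of_real ` Z \<subseteq> {z \<in> of_real ` {a..b}. E z = 0}"
    by (auto simp: Z_def E)
  show ?thesis
  proof (cases "E constant_on UNIV")
    case False
    have "compact (of_real ` {a..b} :: complex set)"
      by (intro compact_continuous_image continuous_intros) auto
    then have "finite {z \<in> of_real ` {a..b}. E z = 0}"
      using holomorphic_compact_finite_zeros[OF hol] False by auto
    then have "finite (of_real ` Z :: complex set)"
      using sub finite_subset by blast
    then show ?thesis
      unfolding Z_def by (auto dest: finite_imageD simp: inj_on_def)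
  next
    case True
    then obtain e where e: "\<And>s. E s = e" by (auto simp: constant_on_def)
    show ?thesis
    proof (cases "Z = {}")
      case False
      then have "e = 0" using sub e by auto
      then show ?thesis using e E by auto
    next
      case True
      then have "finite Z" by simp
      then show ?thesis unfolding Z_def by blast
    qed
  qed
qed

text \<open>The integrand is the derivative of \<open>arc_primitive\<close> along the rotated curve,
  except where the curve meets the lines carrying the two sides of the sector. For finitely many
  such parameters the fundamental theorem of calculus still applies, and closedness of the curve
  gives zero.\<close>

lemma closed_curve_sector_integral:
  assumes H: "H holomorphic_on UNIV" "\<And>\<theta>. H (of_real \<theta>) \<noteq> 0" "H (of_real b) = H (of_real a)"
    and "a \<le> b" "0 < \<alpha>" "\<alpha> \<le> 2 * pi"
  shows "((\<lambda>\<theta>. Im (deriv H (of_real \<theta>) / H (of_real \<theta>)) *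
    (indicator (sector \<beta> (\<beta> + \<alpha>)) (H (of_real \<theta>)) - \<alpha> / (2 * pi))) has_integral 0) {a..b}"
    (is "(?g has_integral 0) _")
proof -
  have dH: "(H has_field_derivative deriv H s) (at s)" for s
    using H(1) by (simp add: holomorphic_derivI[OF _ open_UNIV])
  define h where "h \<gamma> s = cis (- \<gamma>) * H s" for \<gamma> s
  have hol: "h \<gamma> holomorphic_on UNIV" for \<gamma>
    unfolding h_def by (intro holomorphic_intros H)
  have dh: "(h \<gamma> has_field_derivative cis (- \<gamma>) * deriv H s) (at s)" for \<gamma> s
    unfolding h_def by (intro DERIV_cmult dH)
  have dh': "((\<lambda>\<theta>. h \<gamma> (of_real \<theta>)) has_vector_derivative cis (- \<gamma>) * deriv H (of_real \<theta>)) (at \<theta>)"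
    for \<gamma> \<theta>
    by (rule has_vector_derivative_real_field) (rule dh)
  \<comment> \<open>The parameters at which the curve lies on the line through the origin with
    direction \<open>\<gamma>\<close>.\<close>
  define Z where "Z \<gamma> = {\<theta> \<in> {a..b}. Im (h \<gamma> (of_real \<theta>)) = 0}" for \<gamma>
  show ?thesis
  \<comment> \<open>A curve that stays on one line through the origin has infinitely many
    exceptional parameters, but then its angular velocity is identically zero.\<close>
  proof (cases "\<exists>\<gamma>. \<forall>\<theta>. Im (h \<gamma> (of_real \<theta>)) = 0")
    case True
    then obtain \<gamma> where \<gamma>: "\<And>\<theta>. Im (h \<gamma> (of_real \<theta>)) = 0" by blast
    have "Im (deriv H (of_real \<theta>) / H (of_real \<theta>)) = 0" for \<theta>
    proof -
      have "((\<lambda>\<theta>. Im (h \<gamma> (of_real \<theta>))) has_vector_derivative Im (cis (- \<gamma>) * deriv H (of_real \<theta>))) (at \<theta>)"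
        by (rule bounded_linear.has_vector_derivative[OF bounded_linear_Im dh'])
      moreover have "((\<lambda>\<theta>. Im (h \<gamma> (of_real \<theta>))) has_vector_derivative 0) (at \<theta>)"
        by (simp add: \<gamma>)
      ultimately have "Im (cis (- \<gamma>) * deriv H (of_real \<theta>)) = 0"
        by (rule vector_derivative_unique_at)
      with \<gamma>[of \<theta>] have "Im ((cis (- \<gamma>) * deriv H (of_real \<theta>)) / h \<gamma> (of_real \<theta>)) = 0"
        by (simp add: Im_divide)
      then show ?thesis by (simp add: h_def)
    qed
    then have "?g = (\<lambda>_. 0)" by auto
    then show ?thesis by simp
  next
    case False
    then have fin: "finite (Z \<gamma>)" for \<gamma>
      unfolding Z_def using finite_real_zeros_of_imag_part[OF hol] by blast
    define G where "G \<theta> = arc_primitive \<alpha> (h \<beta> (of_real \<theta>))" for \<theta>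
    have "(?g has_integral (G b - G a)) {a..b}"
    proof (rule fundamental_theorem_of_calculus_strong)
      show "finite (Z \<beta> \<union> Z (\<beta> + \<alpha>))" using fin by simp
      have "isCont (arc_primitive \<alpha> \<circ> (\<lambda>\<theta>. h \<beta> (of_real \<theta>))) \<theta>" for \<theta>
        using assms dh'
        by (intro continuous_at_compose continuous_at_arc_primitive has_vector_derivative_continuous[OF dh']) (auto simp: h_def)
      then show "continuous_on {a..b} G"
        unfolding G_def by (auto intro!: continuous_at_imp_continuous_on simp: o_def)
    next
      fix \<theta> assume "\<theta> \<in> {a..b} - (Z \<beta> \<union> Z (\<beta> + \<alpha>))"
      then have nz: "Im (h \<beta> (of_real \<theta>)) \<noteq> 0" "Im (h (\<beta> + \<alpha>) (of_real \<theta>)) \<noteq> 0"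
        by (auto simp: Z_def)
      \<comment> \<open>\<open>Arg2pi\<close> off the positive axis, expressed through the principal
        logarithm so that it can be differentiated.\<close>
      define L where "L t = Im (Ln (- h \<beta> (of_real t))) + pi" for t
      have "((\<lambda>s. Ln (- h \<beta> s)) has_field_derivative deriv H (of_real \<theta>) / H (of_real \<theta>)) (at (of_real \<theta>))"
      proof -
        have "- h \<beta> (of_real \<theta>) \<notin> \<real>\<^sub>\<le>\<^sub>0" using nz(1) by (auto simp: complex_nonpos_Reals_iff)
        from DERIV_chain2[OF has_field_derivative_Ln[OF this] DERIV_minus[OF dh]]
        show ?thesis by (simp add: h_def field_simps)
      qed
      then have "((\<lambda>t. Ln (- h \<beta> (of_real t))) has_vector_derivative deriv H (of_real \<theta>) / H (of_real \<theta>)) (at \<theta>)"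
        by (rule has_vector_derivative_real_field)
      from bounded_linear.has_vector_derivative[OF bounded_linear_Im this]
      have dL: "(L has_real_derivative Im (deriv H (of_real \<theta>) / H (of_real \<theta>))) (at \<theta>)"
        unfolding L_def has_real_derivative_iff_has_vector_derivative by (auto intro!: derivative_eq_intros)
      have L: "Arg2pi (h \<beta> (of_real t)) = L t" if "Im (h \<beta> (of_real t)) \<noteq> 0" for t
        unfolding L_def using that Arg2pi_eq_0[of "h \<beta> (of_real t)"] Arg2pi[of "h \<beta> (of_real t)"]
        by (intro Arg2pi_Ln) (auto simp: complex_is_Real_iff less_le)
      have L\<theta>: "0 < L \<theta>" "L \<theta> = Arg2pi (h \<beta> (of_real \<theta>))"
        using L[OF nz(1)] nz(1) Arg2pi_eq_0[of "h \<beta> (of_real \<theta>)"] Arg2pi[of "h \<beta> (of_real \<theta>)"]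
        by (auto simp: complex_is_Real_iff less_le)
      have "isCont (\<lambda>t. Im (h \<beta> (of_real t))) \<theta>"
        by (intro continuous_Im has_vector_derivative_continuous[OF dh'])
      then have "\<forall>\<^sub>F t in at \<theta>. Im (h \<beta> (of_real t)) \<noteq> 0"
        using nz(1) by (intro tendsto_imp_eventually_ne) (auto simp: isCont_def)
      then have ev: "\<forall>\<^sub>F t in nhds \<theta>. Im (h \<beta> (of_real t)) \<noteq> 0"
        using nz(1) by (simp add: eventually_nhds_conv_at)
      have ne: "L \<theta> \<noteq> \<alpha>"
      proof
        assume "L \<theta> = \<alpha>"
        then have "h \<beta> (of_real \<theta>) = of_real (norm (h \<beta> (of_real \<theta>))) * cis \<alpha>"
          using Arg2pi_eq[of "h \<beta> (of_real \<theta>)"] L\<theta> by (simp add: cis_conv_exp)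
        then have "cis (- \<alpha>) * h \<beta> (of_real \<theta>) = of_real (norm (h \<beta> (of_real \<theta>)))"
          by (metis (no_types, lifting) cis_mult cis_zero mult.commute mult.left_commute mult.right_neutral
              add.left_inverse)
        moreover have "cis (- \<alpha>) * h \<beta> (of_real \<theta>) = h (\<beta> + \<alpha>) (of_real \<theta>)"
          unfolding h_def mult.assoc[symmetric] cis_mult by (simp only: minus_add)
        ultimately show False using nz(2) by (metis Im_complex_of_real)
      qed
      have cL: "isCont L \<theta>" using dL by (rule DERIV_isCont)
      have ind: "indicator (sector \<beta> (\<beta> + \<alpha>)) (H (of_real \<theta>)) = (if L \<theta> < \<alpha> then 1 else 0 :: real)"
        using L\<theta> H(2)[of \<theta>] assms by (auto simp: sector_iff_Arg2pi h_def indicator_def)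
      \<comment> \<open>Away from both sides of the sector the minimum in
        \<open>arc_primitive\<close> is taken by the same term on a whole neighbourhood. Its slope
        is \<open>1 - \<alpha> / (2 * pi)\<close> inside the sector and
        \<open>- \<alpha> / (2 * pi)\<close> outside.\<close>
      have "(G has_real_derivative ?g \<theta>) (at \<theta>)"
      proof (cases "L \<theta> < \<alpha>")
        case True
        then have "\<forall>\<^sub>F t in nhds \<theta>. L t < \<alpha>"
          using cL unfolding isCont_def
          by (auto intro!: order_tendstoD eventually_nhds_conv_at[THEN iffD2])
        with ev have "\<forall>\<^sub>F t in nhds \<theta>. G t = L t - \<alpha> / (2 * pi) * L t"
          by eventually_elim (simp add: G_def arc_primitive_def L)
        moreover have "((\<lambda>t. L t - \<alpha> / (2 * pi) * L t) has_real_derivative ?g \<theta>) (at \<theta>)"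
          using True unfolding ind by (auto intro!: derivative_eq_intros dL simp: algebra_simps)
        ultimately show ?thesis by (subst DERIV_cong_ev[OF refl _ refl])
      next
        case False
        then have "L \<theta> > \<alpha>" using ne by simp
        then have "\<forall>\<^sub>F t in nhds \<theta>. L t > \<alpha>"
          using cL unfolding isCont_def
          by (auto intro!: order_tendstoD eventually_nhds_conv_at[THEN iffD2])
        with ev have "\<forall>\<^sub>F t in nhds \<theta>. G t = \<alpha> - \<alpha> / (2 * pi) * L t"
          by eventually_elim (simp add: G_def arc_primitive_def L)
        moreover have "((\<lambda>t. \<alpha> - \<alpha> / (2 * pi) * L t) has_real_derivative ?g \<theta>) (at \<theta>)"
          using False unfolding ind by (auto intro!: derivative_eq_intros dL simp: algebra_simps)
        ultimately show ?thesis by (subst DERIV_cong_ev[OF refl _ refl])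
      qed
      then show "(G has_vector_derivative ?g \<theta>) (at \<theta>)"
        by (simp add: has_real_derivative_iff_has_vector_derivative)
    qed (use assms in auto)
    moreover have "G b = G a" by (simp add: G_def h_def assms)
    ultimately show ?thesis by simp
  qed
qed

text \<open>The circle is parametrized by an entire function, so that its image under
  \<open>f\<close> is a closed curve of the kind just treated. The logarithmic derivative in the
  parameter is \<i> times \<open>z f' / f\<close>, whence the real part here.\<close>

lemma circle_sector_integral:
  assumes f: "f holomorphic_on UNIV" "\<And>w. norm w = norm z \<Longrightarrow> f w \<noteq> 0"
    and \<alpha>: "0 < \<alpha>" "\<alpha> \<le> 2 * pi"
  shows "((\<lambda>\<theta>. Re (cis \<theta> * z * deriv f (cis \<theta> * z) / f (cis \<theta> * z)) *
    (indicator (sector \<beta> (\<beta> + \<alpha>)) (f (cis \<theta> * z)) - \<alpha> / (2 * pi))) has_integral 0) {0..2 * pi}"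
proof -
  define H where "H s = f (exp (\<i> * s) * z)" for s
  have df: "(f has_field_derivative deriv f s) (at s)" for s
    using f(1) by (simp add: holomorphic_derivI[OF _ open_UNIV])
  have "(H has_field_derivative deriv f (exp (\<i> * s) * z) * (\<i> * exp (\<i> * s) * z)) (at s)" for s
    unfolding H_def by (rule DERIV_chain2[OF df]) (auto intro!: derivative_eq_intros)
  then have dH: "deriv H s = deriv f (exp (\<i> * s) * z) * (\<i> * exp (\<i> * s) * z)"
    and "H field_differentiable at s" for s
    by (auto intro: DERIV_imp_deriv simp: field_differentiable_def)
  then have "H holomorphic_on UNIV"
    by (auto simp: holomorphic_on_def intro: field_differentiable_at_within)
  moreover have "H (of_real \<theta>) = f (cis \<theta> * z)" for \<theta>
    by (simp add: H_def cis_conv_exp)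
  moreover have "Im (deriv H (of_real \<theta>) / H (of_real \<theta>))
      = Re (cis \<theta> * z * deriv f (cis \<theta> * z) / f (cis \<theta> * z))" for \<theta>
  proof -
    have "deriv H (of_real \<theta>) / H (of_real \<theta>) = \<i> * (cis \<theta> * z * deriv f (cis \<theta> * z) / f (cis \<theta> * z))"
      unfolding dH by (simp add: H_def cis_conv_exp)
    then show ?thesis by (simp only: Im_i_times)
  qed
  moreover have "H (of_real (2 * pi)) = H (of_real 0)"
    using exp_two_pi_i by (simp add: H_def mult_ac)
  ultimately show ?thesis
    using closed_curve_sector_integral[of H "2 * pi" 0 \<alpha> \<beta>] f(2) \<alpha>
    by (simp add: norm_mult)
qed

subsection \<open>Zeros and the logarithmic derivative\<close>

definition zeros_in :: "(complex \<Rightarrow> complex) \<Rightarrow> real \<Rightarrow> complex set" where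
  "zeros_in f R = {a \<in> cball 0 R. f a = 0}"

definition zmult :: "(complex \<Rightarrow> complex) \<Rightarrow> complex \<Rightarrow> nat" where
  "zmult f a = nat (zorder f a)"

text \<open>The counting function n(R) of value distribution theory, with multiplicities and for the
  closed disc.\<close>

definition zero_count :: "(complex \<Rightarrow> complex) \<Rightarrow> real \<Rightarrow> nat" where
  "zero_count f R = (\<Sum>a\<in>zeros_in f R. zmult f a)"

lemma finite_zeros_in:
  assumes "f holomorphic_on UNIV" "\<not> f constant_on UNIV"
  shows "finite (zeros_in f R)"
  unfolding zeros_in_def using assms by (intro holomorphic_compact_finite_zeros) auto

text \<open>\<open>f\<close> may vanish at the origin, so this point replaces it as base point of
  the growth estimates.\<close>

lemma exists_nonzero_in_disc:
  assumes "f holomorphic_on UNIV" "\<not> f constant_on UNIV"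
  shows "\<exists>p. f p \<noteq> 0 \<and> norm p \<le> 1"
proof -
  have "infinite (cball (0::complex) 1)"
    using uncountable_cball[of 1 "0::complex"] countable_finite by auto
  then have "zeros_in f 1 \<noteq> cball 0 1" using finite_zeros_in[OF assms, of 1] by auto
  then show ?thesis by (auto simp: zeros_in_def)
qed

lemma zero_count_mono:
  assumes "f holomorphic_on UNIV" "\<not> f constant_on UNIV" "r \<le> R"
  shows "zero_count f r \<le> zero_count f R"
  unfolding zero_count_def
  using assms by (intro sum_mono2 finite_zeros_in) (auto simp: zeros_in_def)

text \<open>Zeros are removed one at a time. The factors already split off do not vanish at the new
  zero \<open>b\<close>, so \<open>g\<close> has there a zero of the same order as \<open>f\<close>,
  and dividing by that power of \<open>z - b\<close> leaves a removable singularity.\<close>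

lemma factor_out_zeros:
  assumes f: "f holomorphic_on UNIV" "f w \<noteq> 0" and Z: "finite Z" "\<And>a. a \<in> Z \<Longrightarrow> f a = 0"
  shows "\<exists>g. g holomorphic_on UNIV \<and> (\<forall>z. f z = g z * (\<Prod>a\<in>Z. (z - a) ^ zmult f a)) \<and> (\<forall>a\<in>Z. g a \<noteq> 0)"
  using Z
proof (induction Z rule: finite_induct)
  case empty
  then show ?case using f by auto
next
  case (insert b Z)
  then obtain g where g: "g holomorphic_on UNIV" "\<And>z. f z = g z * (\<Prod>a\<in>Z. (z - a) ^ zmult f a)"
    "\<And>a. a \<in> Z \<Longrightarrow> g a \<noteq> 0"
    by auto
  define P where "P z = (\<Prod>a\<in>Z. (z - a) ^ zmult f a)" for z
  have "f b = 0" using insert by simp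
  obtain q r where r: "r > 0" and q: "q holomorphic_on cball b r"
    "\<And>z. z \<in> cball b r \<Longrightarrow> f z = q z * (z - b) ^ zmult f b \<and> q z \<noteq> 0"
    and "zorder f b > 0"
  proof -
    have "\<exists>w\<in>UNIV. f w \<noteq> 0" using f(2) by blast
    from zorder_exist_zero[OF f(1) open_UNIV connected_UNIV UNIV_I this, of b] \<open>f b = 0\<close>
    obtain r where "0 < zorder f b" "0 < r" "zor_poly f b holomorphic_on cball b r"
      "\<And>w. w \<in> cball b r \<Longrightarrow> f w = zor_poly f b w * (w - b) ^ zmult f b \<and> zor_poly f b w \<noteq> 0"
      unfolding zmult_def by auto
    then show ?thesis using that by blast
  qed
  then have n: "zmult f b > 0" by (simp add: zmult_def)
  have "open (- Z)" using insert(1) by (simp add: finite_imp_closed open_Compl)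
  then obtain d where d: "d > 0" "ball b d \<subseteq> - Z"
    using insert(2) by (meson ComplI open_contains_ball)
  define B where "B = ball b (min d r)"
  have P: "P z \<noteq> 0" if "z \<in> B" for z
  proof -
    have "z \<notin> Z" using that d by (auto simp: B_def)
    then show ?thesis using insert(1) by (auto simp: P_def)
  qed
  \<comment> \<open>The value at \<open>b\<close> comes from the local factorization of
    \<open>f\<close>; near \<open>b\<close> the quotient is \<open>q / P\<close> throughout.\<close>
  define g' where "g' z = (if z = b then q b / P b else g z / (z - b) ^ zmult f b)" for z
  have bB: "b \<in> B" using d r by (simp add: B_def)
  have B: "z \<in> cball b r" if "z \<in> B" for z
    using that by (auto simp: B_def)
  have eq: "g' z = q z / P z" if "z \<in> B" for z
  proof (cases "z = b")
    case False
    have "g z * P z = q z * (z - b) ^ zmult f b"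
      using q(2)[OF B[OF that]] g(2)[of z] unfolding P_def by simp
    then show ?thesis
      using False P[OF that] by (simp add: g'_def field_simps)
  qed (simp add: g'_def)
  have "(\<lambda>z. q z / P z) holomorphic_on B"
  proof (intro holomorphic_on_divide P)
    show "q holomorphic_on B" using holomorphic_on_subset[OF q(1)] B by blast
    show "P holomorphic_on B" unfolding P_def by (intro holomorphic_intros)
  qed auto
  then have "g' holomorphic_on B"
    by (rule holomorphic_transform) (simp add: eq)
  moreover have "(\<lambda>z. g z / (z - b) ^ zmult f b) holomorphic_on - {b}"
    using g(1) by (intro holomorphic_intros) (auto intro: holomorphic_on_subset)
  then have "g' holomorphic_on - {b}"
    by (rule holomorphic_transform) (simp add: g'_def)
  ultimately have "g' holomorphic_on (B \<union> - {b})"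
    by (intro holomorphic_on_Un) (auto simp: B_def)
  moreover have "B \<union> - {b} = UNIV" using bB by auto
  ultimately have "g' holomorphic_on UNIV" by simp
  moreover have "f z = g' z * (\<Prod>a\<in>insert b Z. (z - a) ^ zmult f a)" for z
  proof (cases "z = b")
    case False
    then show ?thesis using insert g(2)[of z] by (simp add: g'_def)
  qed (use insert n \<open>f b = 0\<close> in simp)
  moreover have "g' a \<noteq> 0" if "a \<in> insert b Z" for a
  proof (cases "a = b")
    case True
    then show ?thesis using eq[OF bB] P[OF bB] q(2)[OF B[OF bB]] by simp
  next
    case False
    then show ?thesis using that g(3) by (simp add: g'_def)
  qed
  ultimately show ?case by blast
qed

section \<open>Growth and the number of zeros\<close>

lemma norm_le_max_modulus:
  assumes "f holomorphic_on UNIV" "norm z \<le> r"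
  shows "norm (f z) \<le> max_modulus r f"
proof -
  have "continuous_on (cball 0 r) (\<lambda>z. norm (f z))"
    using assms by (intro continuous_intros) (meson holomorphic_on_imp_continuous_on continuous_on_subset subset_UNIV)
  then have "bdd_above ((\<lambda>z. norm (f z)) ` cball 0 r)"
    by (intro bounded_imp_bdd_above compact_imp_bounded compact_continuous_image) auto
  then show ?thesis
    unfolding max_modulus_def using assms by (intro cSUP_upper) auto
qed

text \<open>On the circle of radius \<open>6 * R\<close> every zero is at least twice as far away as
  it is from \<open>p\<close>. Each zero thus gains a factor 2 in the comparison of \<open>g\<close>
  with \<open>g p\<close>, and the maximum principle carries the bound inside.\<close>

lemma factor_out_zeros_in_disc:
  assumes f: "f holomorphic_on UNIV" "\<not> f constant_on UNIV"
    and p: "f p \<noteq> 0" "norm p \<le> 1" and R: "R \<ge> 1"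
  shows "\<exists>g. g holomorphic_on UNIV \<and>
    (\<forall>z. f z = g z * (\<Prod>a\<in>zeros_in f R. (z - a) ^ zmult f a)) \<and>
    (\<forall>z\<in>cball 0 R. g z \<noteq> 0) \<and>
    (\<forall>z\<in>cball 0 (6 * R).
      norm (g z) \<le> norm (g p) * (max_modulus (6 * R) f / (norm (f p) * 2 ^ zero_count f R)))"
proof -
  define Z where "Z = zeros_in f R"
  have Z: "finite Z" "\<And>a. a \<in> Z \<Longrightarrow> f a = 0 \<and> norm a \<le> R"
    using finite_zeros_in[OF f] by (auto simp: Z_def zeros_in_def)
  obtain g where g: "g holomorphic_on UNIV" "\<And>z. f z = g z * (\<Prod>a\<in>Z. (z - a) ^ zmult f a)"
    "\<And>a. a \<in> Z \<Longrightarrow> g a \<noteq> 0"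
    using factor_out_zeros[OF f(1) p(1) Z(1)] Z(2) by auto
  have nz: "g z \<noteq> 0" if "z \<in> cball 0 R" for z
    using that g(2)[of z] g(3)[of z] by (cases "f z = 0") (auto simp: Z_def zeros_in_def)
  define P where "P z = (\<Prod>a\<in>Z. norm (z - a) ^ zmult f a)" for z
  have fP: "norm (f z) = norm (g z) * P z" for z
    using g(2)[of z] by (simp add: P_def norm_mult prod_norm[symmetric] norm_power)
  define N where "N = zero_count f R"
  have sphere: "norm (g z) \<le> norm (g p) * (max_modulus (6 * R) f / (norm (f p) * 2 ^ N))"
    if z: "norm z = 6 * R" for z
  proof -
    \<comment> \<open>The distance from \<open>z\<close> to \<open>a\<close> is at least
      \<open>5 * R\<close>, that from \<open>p\<close> to \<open>a\<close> at most
      \<open>2 * R\<close>.\<close>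
    have "2 * norm (p - a) \<le> norm (z - a)" if "a \<in> Z" for a
      using Z(2)[OF that] p(2) R z norm_triangle_ineq4[of p a] norm_triangle_ineq2[of z a] by linarith
    then have "(\<Prod>a\<in>Z. (2 * norm (p - a)) ^ zmult f a) \<le> P z"
      unfolding P_def by (intro prod_mono conjI power_mono) auto
    also have "(\<Prod>a\<in>Z. (2 * norm (p - a)) ^ zmult f a) = 2 ^ N * P p"
      by (simp add: P_def N_def zero_count_def Z_def power_mult_distrib prod.distrib power_sum)
    finally have "2 ^ N * P p \<le> P z" .
    moreover have "norm (g z) * P z \<le> max_modulus (6 * R) f"
      using norm_le_max_modulus[OF f(1)] z by (simp flip: fP)
    ultimately have "norm (g z) * (2 ^ N * P p) \<le> max_modulus (6 * R) f"
      by (meson mult_left_mono norm_ge_zero order_trans)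
    moreover have "P p \<noteq> 0" "norm (g p) \<noteq> 0" "P p \<ge> 0" using p fP[of p] by (auto simp: P_def prod_nonneg)
    ultimately show ?thesis
      unfolding fP[of p] by (simp add: field_simps)
  qed
  have "norm (g z) \<le> norm (g p) * (max_modulus (6 * R) f / (norm (f p) * 2 ^ N))"
    if "z \<in> cball 0 (6 * R)" for z
  proof (rule maximum_modulus_frontier[where S = "cball 0 (6 * R)" and f = g])
    show "g holomorphic_on interior (cball 0 (6 * R))" "continuous_on (closure (cball 0 (6 * R))) g"
      using g(1) by (meson holomorphic_on_subset subset_UNIV holomorphic_on_imp_continuous_on)+
  qed (use that sphere R in auto)
  with g nz show ?thesis unfolding Z_def N_def by blast
qed

text \<open>A substitute for Jensen's formula: the estimate of \<open>g\<close> is evaluated at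
  \<open>p\<close> itself and divided by \<open>norm (g p)\<close>.\<close>

lemma two_power_zero_count_le:
  assumes f: "f holomorphic_on UNIV" "\<not> f constant_on UNIV"
    and p: "f p \<noteq> 0" "norm p \<le> 1" and R: "R \<ge> 1"
  shows "2 ^ zero_count f R \<le> max_modulus (6 * R) f / norm (f p)"
proof -
  obtain g where "g holomorphic_on UNIV" "\<And>z. f z = g z * (\<Prod>a\<in>zeros_in f R. (z - a) ^ zmult f a)"
    and g: "\<And>z. z \<in> cball 0 R \<Longrightarrow> g z \<noteq> 0"
    "\<And>z. z \<in> cball 0 (6 * R) \<Longrightarrow>
      norm (g z) \<le> norm (g p) * (max_modulus (6 * R) f / (norm (f p) * 2 ^ zero_count f R))"
    using factor_out_zeros_in_disc[OF assms] by blast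
  have "norm (g p) > 0" using g(1)[of p] p R by simp
  moreover have "norm (g p) * 1 \<le> norm (g p) * (max_modulus (6 * R) f / (norm (f p) * 2 ^ zero_count f R))"
    using g(2)[of p] p R by simp
  ultimately have "1 \<le> max_modulus (6 * R) f / (norm (f p) * 2 ^ zero_count f R)"
    by (simp only: mult_le_cancel_left_pos)
  then show ?thesis using p by (simp add: field_simps)
qed

section \<open>Logarithmic derivatives of zero-free functions\<close>

text \<open>A form of the Borel--Caratheodory theorem, obtained from the Schwarz lemma for \<open>h / (2 A - h)\<close>.\<close>
lemma norm_le_if_Re_less:
  assumes h: "h holomorphic_on ball p \<rho>" "h p = 0" and \<rho>: "\<rho> > 0"
    and Re: "\<And>z. z \<in> ball p \<rho> \<Longrightarrow> Re (h z) < A" and z: "dist p z \<le> 3 / 4 * \<rho>"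
  shows "norm (h z) \<le> 6 * A"
proof -
  have "A > 0" using Re[of p] h \<rho> by simp
  define k where "k w = h (p + of_real \<rho> * w)" for w
  define \<phi> where "\<phi> w = k w / (2 * of_real A - k w)" for w
  have in_ball: "p + of_real \<rho> * w \<in> ball p \<rho>" if "norm w < 1" for w
    using that \<rho> by (simp add: dist_norm norm_mult)
  have Rek: "Re (k w) < A" if "norm w < 1" for w
    unfolding k_def using Re in_ball that by blast
  have "(\<lambda>w. p + of_real \<rho> * w) ` ball 0 1 \<subseteq> ball p \<rho>"
    using in_ball by auto
  then have "h \<circ> (\<lambda>w. p + of_real \<rho> * w) holomorphic_on ball 0 1"
    by (intro holomorphic_on_compose holomorphic_intros) (auto intro: holomorphic_on_subset[OF h(1)])
  then have kh: "k holomorphic_on ball 0 1" by (simp add: k_def[abs_def] o_def)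
  have ne: "2 * of_real A - k w \<noteq> 0" if "norm w < 1" for w
    using Rek[OF that] \<open>A > 0\<close> by (auto simp: complex_eq_iff)
  have "\<phi> holomorphic_on ball 0 1"
    unfolding \<phi>_def using ne by (intro holomorphic_intros kh) auto
  moreover have "\<phi> 0 = 0" by (simp add: \<phi>_def k_def h)
  moreover have lt: "norm (\<phi> w) < 1" if "norm w < 1" for w
  proof -
    \<comment> \<open>In the half-plane where the real part is below \<open>A\<close>, points are
      nearer to 0 than to its mirror image \<open>2 * A\<close>.\<close>
    have "(norm (k w))\<^sup>2 < (norm (2 * of_real A - k w))\<^sup>2"
      using Rek[OF that] \<open>A > 0\<close> mult_strict_left_mono[of "Re (k w)" A A]
      unfolding cmod_power2 by (simp add: power2_eq_square algebra_simps)
    then have "norm (k w) < norm (2 * of_real A - k w)"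
      by (rule power2_less_imp_less) simp
    then show ?thesis by (simp add: \<phi>_def norm_divide divide_less_eq)
  qed
  ultimately have Sch: "norm (\<phi> w) \<le> norm w" if "norm w < 1" for w
    using Schwarz_Lemma(1)[of \<phi> w] that by blast
  define w where "w = (z - p) / of_real \<rho>"
  have w: "norm w \<le> 3 / 4" "k w = h z"
    using z \<rho> by (auto simp: w_def k_def norm_divide dist_norm norm_minus_commute field_simps)
  have "norm (k w) = norm (\<phi> w) * norm (2 * of_real A - k w)"
    using ne[of w] w by (simp add: \<phi>_def norm_divide)
  \<comment> \<open>Solving this inequality for \<open>norm (k w)\<close> gives the factor
    6.\<close>
  also have "\<dots> \<le> 3 / 4 * (2 * A + norm (k w))"
    using Sch[of w] w norm_triangle_ineq4[of "2 * of_real A" "k w"] \<open>A > 0\<close>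
    by (intro mult_mono) (auto simp: norm_mult)
  finally show ?thesis using w by simp
qed

text \<open>A zero-free function on a disc has a holomorphic logarithm. The growth bound limits the
  real part of its increment by \<open>ln B\<close>, the preceding lemma then its modulus by
  \<open>6 * ln B\<close>, and Cauchy's estimate on a circle of radius \<open>\<rho> / 4\<close> its
  derivative.\<close>

lemma norm_logderiv_le:
  assumes g: "g holomorphic_on ball p \<rho>" "\<And>z. z \<in> ball p \<rho> \<Longrightarrow> g z \<noteq> 0"
    and \<rho>: "\<rho> > 0" and B: "\<And>z. z \<in> ball p \<rho> \<Longrightarrow> norm (g z) < norm (g p) * B"
    and z: "dist p z \<le> \<rho> / 2"
  shows "norm (deriv g z / g z) \<le> 24 * ln B / \<rho>"
proof -
  have "p \<in> ball p \<rho>" using \<rho> by simp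
  then obtain h where h: "h holomorphic_on ball p \<rho>" "\<And>w. w \<in> ball p \<rho> \<Longrightarrow> exp (h w) = g w"
    using holomorphic_logarithm_exists[OF convex_ball open_ball g] by metis
  define k where "k w = h w - h p" for w
  have k: "k holomorphic_on ball p \<rho>" "k p = 0"
    unfolding k_def using h by (auto intro!: holomorphic_intros)
  have "norm (g p) > 0" using g(2) \<open>p \<in> ball p \<rho>\<close> by simp
  then have "B > 0" using B[OF \<open>p \<in> ball p \<rho>\<close>] by (simp add: mult_less_cancel_left1 zero_less_mult_iff)
  have Rek: "Re (k w) < ln B" if "w \<in> ball p \<rho>" for w
  proof -
    have "exp (Re (k w)) = norm (exp (k w))" by simp
    also have "exp (k w) = g w / g p"
      using h(2) that \<open>p \<in> ball p \<rho>\<close> by (simp add: k_def exp_diff)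
    also have "norm (g w / g p) < B"
      using B[OF that] \<open>norm (g p) > 0\<close> by (simp add: norm_divide divide_less_eq mult.commute)
    finally show ?thesis using \<open>B > 0\<close> by (metis exp_less_cancel_iff exp_ln)
  qed
  have sub: "cball z (\<rho> / 4) \<subseteq> ball p \<rho>" "\<And>x. x \<in> cball z (\<rho> / 4) \<Longrightarrow> dist p x \<le> 3 / 4 * \<rho>"
  proof -
    show *: "dist p x \<le> 3 / 4 * \<rho>" if "x \<in> cball z (\<rho> / 4)" for x
      using that z dist_triangle[of p x z] by auto
    show "cball z (\<rho> / 4) \<subseteq> ball p \<rho>" using * \<rho> by force
  qed
  have "norm ((deriv ^^ 1) k z) \<le> fact 1 * (6 * ln B) / (\<rho> / 4) ^ 1"
  proof (rule Cauchy_inequality)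
    show "k holomorphic_on ball z (\<rho> / 4)" "continuous_on (cball z (\<rho> / 4)) k"
      using sub(1) k(1) ball_subset_cball by (meson holomorphic_on_subset order_trans holomorphic_on_imp_continuous_on)+
    show "norm (k x) \<le> 6 * ln B" if "norm (z - x) = \<rho> / 4" for x
      by (rule norm_le_if_Re_less[OF k \<rho> Rek sub(2)]) (use that in \<open>auto simp: dist_norm\<close>)
  qed (use \<rho> in simp)
  then have 1: "norm (deriv k z) \<le> 24 * ln B / \<rho>" by simp
  have zb: "z \<in> ball p \<rho>" using z \<rho> by simp
  have "(k has_field_derivative deriv k z) (at z)"
    using k(1) zb by (simp add: holomorphic_derivI)
  then have "((\<lambda>w. g p * exp (k w)) has_field_derivative g p * (exp (k z) * deriv k z)) (at z)"
    by (intro DERIV_cmult DERIV_fun_exp)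
  moreover have ev: "g p * exp (k w) = g w" if "w \<in> ball p \<rho>" for w
    using h(2) that \<open>p \<in> ball p \<rho>\<close> g(2)[OF \<open>p \<in> ball p \<rho>\<close>] by (simp add: k_def exp_diff)
  ultimately have "(g has_field_derivative g p * (exp (k z) * deriv k z)) (at z)"
    using has_field_derivative_transform_within_open[OF _ open_ball zb] by blast
  then have "deriv g z = g z * deriv k z"
    using ev[OF zb] by (metis DERIV_imp_deriv mult.assoc)
  then show ?thesis using 1 g(2)[OF zb] by simp
qed

lemma logderiv_factorization:
  assumes g: "g holomorphic_on UNIV" "\<And>z. f z = g z * (\<Prod>a\<in>Z. (z - a) ^ m a)"
    and z: "f z \<noteq> 0" and Z: "finite Z"
  shows "deriv f z / f z = deriv g z / g z + (\<Sum>a\<in>Z. of_nat (m a) / (z - a))"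
proof -
  define P where "P z = (\<Prod>a\<in>Z. (z - a) ^ m a)" for z
  have fe: "f = (\<lambda>z. g z * P z)" using g(2) by (auto simp: P_def)
  have nz: "g z \<noteq> 0" "P z \<noteq> 0" using z by (auto simp: fe)
  have nz': "(z - a) ^ m a \<noteq> 0" if "a \<in> Z" for a
    using nz(2) that Z unfolding P_def by auto
  have "(P has_field_derivative
      P z * (\<Sum>a\<in>Z. of_nat (m a) * (z - a) ^ (m a - 1) / (z - a) ^ m a)) (at z)"
    unfolding P_def using nz'
    by (intro has_field_derivative_prod') (auto intro!: derivative_eq_intros)
  moreover have "of_nat (m a) * (z - a) ^ (m a - 1) / (z - a) ^ m a = of_nat (m a) / (z - a)"
    if "a \<in> Z" for a
    using nz'[OF that] by (cases "m a") auto
  ultimately have dP: "(P has_field_derivative P z * (\<Sum>a\<in>Z. of_nat (m a) / (z - a))) (at z)"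
    by simp
  have dg: "(g has_field_derivative deriv g z) (at z)"
    using g(1) by (simp add: holomorphic_derivI[OF _ open_UNIV])
  have "(f has_field_derivative deriv g z * P z + P z * (\<Sum>a\<in>Z. of_nat (m a) / (z - a)) * g z) (at z)"
    unfolding fe by (rule DERIV_mult[OF dg dP])
  then have "deriv f z = deriv g z * P z + P z * (\<Sum>a\<in>Z. of_nat (m a) / (z - a)) * g z"
    by (rule DERIV_imp_deriv)
  then show ?thesis using nz by (simp add: fe field_simps)
qed

section \<open>Consequences of order zero\<close>

lemma ln_max_modulus_le:
  assumes "entire_order f = 0" "\<eta> > 0"
  shows "\<forall>\<^sub>F r in at_top. ln (max_modulus r f) \<le> r powr \<eta>"
proof -
  have "Limsup at_top (\<lambda>r::real. ereal (ln (ln (max_modulus r f)) / ln r)) < ereal \<eta>"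
    using assms by (simp add: entire_order_def zero_ereal_def)
  then have "\<forall>\<^sub>F r::real in at_top. ereal (ln (ln (max_modulus r f)) / ln r) < ereal \<eta>"
    by (rule Limsup_lessD)
  then show ?thesis
    using eventually_gt_at_top[of 1]
  proof eventually_elim
    case (elim r)
    show ?case
    \<comment> \<open>Only for positive \<open>ln (max_modulus r f)\<close> is the outer logarithm
      genuine; otherwise the bound is trivial.\<close>
    proof (cases "ln (max_modulus r f) > 0")
      case True
      have "ln (ln (max_modulus r f)) < \<eta> * ln r"
        using elim by (simp add: divide_less_eq)
      then have "ln (max_modulus r f) < exp (\<eta> * ln r)"
        using True by (metis exp_less_cancel_iff exp_ln)
      then show ?thesis using elim by (simp add: powr_def)
    qed (use powr_ge_zero[of r \<eta>] in linarith)
  qed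
qed

text \<open>This replaces the Hadamard product. The difference is \<open>g' / g\<close> for the
  quotient \<open>g\<close> of \<open>f\<close> by its zeros in a disc of radius \<open>R\<close>;
  its growth there is controlled by \<open>ln (max_modulus (6 * R) f)\<close>, which is of smaller
  order than \<open>R\<close>, so \<open>g' / g\<close> tends to 0 on a fixed disc.\<close>

lemma logderiv_approx:
  assumes f: "f holomorphic_on UNIV" "\<not> f constant_on UNIV" and order: "entire_order f = 0"
    and "\<delta> > 0"
  shows "\<exists>R\<ge>r. \<forall>z. norm z < r \<longrightarrow> f z \<noteq> 0 \<longrightarrow>
    norm (deriv f z / f z - (\<Sum>a\<in>zeros_in f R. of_nat (zmult f a) / (z - a))) \<le> \<delta>"
proof -
  obtain p where p: "f p \<noteq> 0" "norm p \<le> 1"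
    using exists_nonzero_in_disc[OF f] by blast
  define c where "c = ln (2 / norm (f p))"
  have "((\<lambda>R. 24 * (c + (6 * R) powr (1 / 2)) / (R - 1)) \<longlongrightarrow> 0) at_top"
    by real_asymp
  then have "\<forall>\<^sub>F R in at_top. 24 * (c + (6 * R) powr (1 / 2)) / (R - 1) < \<delta>"
    using \<open>\<delta> > 0\<close> by (rule order_tendstoD(2))
  moreover have "filterlim (\<lambda>R::real. 6 * R) at_top at_top" by real_asymp
  then have "\<forall>\<^sub>F R in at_top. ln (max_modulus (6 * R) f) \<le> (6 * R) powr (1 / 2)"
    using ln_max_modulus_le[OF order, of "1 / 2"] by (auto simp: filterlim_iff)
  \<comment> \<open>The bounds 6 and \<open>4 * r\<close> place every point of modulus below
    \<open>r\<close> within \<open>(R - 1) / 2\<close> of \<open>p\<close>, as 1 + R/4 is then at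
    most (R - 1)/2.\<close>
  ultimately have "\<forall>\<^sub>F R in at_top. R \<ge> max 6 (4 * r) \<and> R \<ge> r \<and>
      24 * (c + (6 * R) powr (1 / 2)) / (R - 1) < \<delta> \<and> ln (max_modulus (6 * R) f) \<le> (6 * R) powr (1 / 2)"
    using eventually_ge_at_top[of "max 6 (4 * r)"] eventually_ge_at_top[of r]
    by eventually_elim auto
  then obtain R where R: "R \<ge> 6" "R \<ge> 4 * r" "R \<ge> r"
    "24 * (c + (6 * R) powr (1 / 2)) / (R - 1) < \<delta>" "ln (max_modulus (6 * R) f) \<le> (6 * R) powr (1 / 2)"
    by (auto dest!: eventually_happens)
  obtain g where g: "g holomorphic_on UNIV"
    "\<And>z. f z = g z * (\<Prod>a\<in>zeros_in f R. (z - a) ^ zmult f a)"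
    "\<And>z. z \<in> cball 0 R \<Longrightarrow> g z \<noteq> 0"
    "\<And>z. z \<in> cball 0 (6 * R) \<Longrightarrow>
      norm (g z) \<le> norm (g p) * (max_modulus (6 * R) f / (norm (f p) * 2 ^ zero_count f R))"
  proof -
    have "R \<ge> 1" using R by simp
    from factor_out_zeros_in_disc[OF f p this] that show ?thesis by blast
  qed
  \<comment> \<open>The factor 2 makes the growth bound strict.\<close>
  define B where "B = 2 * max_modulus (6 * R) f / norm (f p)"
  have M: "norm (f p) \<le> max_modulus (6 * R) f"
    by (rule norm_le_max_modulus[OF f(1)]) (use p R in auto)
  then have Mpos: "max_modulus (6 * R) f > 0" using p by (metis less_le_trans zero_less_norm_iff)
  have gp: "norm (g p) > 0" using g(3)[of p] p R by auto
  have sub: "ball p (R - 1) \<subseteq> cball 0 R"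
  proof
    fix x assume "x \<in> ball p (R - 1)"
    then show "x \<in> cball 0 R" using p(2) dist_triangle[of 0 x p] by simp
  qed
  have bound: "norm (g z) < norm (g p) * B" if "z \<in> ball p (R - 1)" for z
  proof -
    have "norm (g z) \<le> norm (g p) * (max_modulus (6 * R) f / (norm (f p) * 2 ^ zero_count f R))"
      using that sub R by (intro g(4)) auto
    also have "\<dots> \<le> norm (g p) * (max_modulus (6 * R) f / norm (f p))"
      using p Mpos by (intro mult_left_mono divide_left_mono) auto
    also have "\<dots> < norm (g p) * B"
      using p Mpos gp by (intro mult_strict_left_mono) (auto simp: B_def divide_strict_right_mono)
    finally show ?thesis .
  qed
  have lnB: "ln B \<le> c + (6 * R) powr (1 / 2)"
  proof -
    have "B = 2 / norm (f p) * max_modulus (6 * R) f" by (simp add: B_def)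
    moreover have "2 / norm (f p) > 0" using p by simp
    ultimately have "ln B = c + ln (max_modulus (6 * R) f)"
      using Mpos by (simp only: c_def ln_mult_pos)
    then show ?thesis using R by simp
  qed
  have "norm (deriv f z / f z - (\<Sum>a\<in>zeros_in f R. of_nat (zmult f a) / (z - a))) \<le> \<delta>"
    if z: "norm z < r" "f z \<noteq> 0" for z
  proof -
    have "dist p z \<le> (R - 1) / 2" using norm_triangle_ineq4[of p z] p z R by (auto simp: dist_norm)
    then have "norm (deriv g z / g z) \<le> 24 * ln B / (R - 1)"
      using g(1,3) sub R bound
      by (intro norm_logderiv_le) (auto intro: holomorphic_on_subset)
    also have "\<dots> \<le> 24 * (c + (6 * R) powr (1 / 2)) / (R - 1)"
      using lnB R by (intro divide_right_mono mult_left_mono) auto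
    also have "\<dots> \<le> \<delta>" using R by simp
    finally show ?thesis
      using logderiv_factorization[OF g(1,2) z(2) finite_zeros_in[OF f]] by simp
  qed
  with R show ?thesis by blast
qed

subsection \<open>Radii with few zeros nearby\<close>

lemma zero_count_pos:
  assumes f: "f holomorphic_on UNIV" "\<not> f constant_on UNIV" and a: "a \<in> zeros_in f R"
  shows "zero_count f R \<ge> 1"
proof -
  have "\<exists>w\<in>UNIV. f w \<noteq> 0" using f(2) by (auto simp: constant_on_def)
  then have "zorder f a > 0"
    using zorder_exist_zero[OF f(1) open_UNIV connected_UNIV, of a] a by (simp add: zeros_in_def)
  then have "1 \<le> zmult f a" by (simp add: zmult_def)
  also have "\<dots> \<le> zero_count f R"
    unfolding zero_count_def by (rule member_le_sum[OF a]) (use finite_zeros_in[OF f] in auto)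
  finally show ?thesis .
qed

text \<open>Without zeros the approximating sums are empty, so the logarithmic derivative is
  arbitrarily small and hence zero everywhere.\<close>

lemma order_zero_has_zero:
  assumes f: "f holomorphic_on UNIV" "\<not> f constant_on UNIV" and order: "entire_order f = 0"
  shows "\<exists>a. f a = 0"
proof (rule ccontr)
  assume "\<not> ?thesis"
  then have nz: "f z \<noteq> 0" for z by auto
  then have Z: "zeros_in f R = {}" for R by (simp add: zeros_in_def)
  have "deriv f z = 0" for z
  proof -
    have "norm (deriv f z / f z) \<le> \<delta>" if "\<delta> > 0" for \<delta>
      using logderiv_approx[OF f order that, of "norm z + 1"] nz by (auto simp: Z)
    then have "norm (deriv f z / f z) \<le> 0"
      by (rule field_le_epsilon) simp
    then show ?thesis using nz by simp
  qed
  then have "(f has_field_derivative 0) (at z)" for z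
    using holomorphic_derivI[OF f(1) open_UNIV, of z] by simp
  then obtain c where "\<And>x. f x = c"
    using has_field_derivative_zero_constant[of UNIV f] by auto
  then show False using f(2) by (auto simp: constant_on_def)
qed

text \<open>The zero count is at most logarithmic in the maximum modulus, whose logarithm grows
  slower than any power of the radius.\<close>

lemma zero_count_subexponential:
  assumes f: "f holomorphic_on UNIV" "\<not> f constant_on UNIV" and order: "entire_order f = 0"
    and y: "y > 1"
  shows "(\<lambda>i. zero_count f (2 ^ i) / y ^ i) \<longlonglongrightarrow> 0"
proof -
  obtain p where p: "f p \<noteq> 0" "norm p \<le> 1" using exists_nonzero_in_disc[OF f] by blast
  \<comment> \<open>Chosen so that \<open>2 powr \<eta> = sqrt y\<close>, which leaves a decaying
    factor \<open>1 / sqrt y\<close> per step.\<close>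
  define \<eta> where "\<eta> = ln y / (2 * ln 2)"
  have \<eta>: "\<eta> > 0" using y by (simp add: \<eta>_def)
  have "filterlim (\<lambda>i. 6 * 2 ^ i :: real) at_top sequentially" by real_asymp
  then have ev: "\<forall>\<^sub>F i in sequentially. ln (max_modulus (6 * 2 ^ i) f) \<le> (6 * 2 ^ i) powr \<eta>"
    using ln_max_modulus_le[OF order \<eta>] by (auto simp: filterlim_iff)
  have pw: "(6 * 2 ^ i) powr \<eta> = 6 powr \<eta> * sqrt y ^ i" for i :: nat
  proof -
    have "2 powr \<eta> = sqrt y"
      using y by (simp add: powr_def \<eta>_def powr_half_sqrt[symmetric])
    moreover have "(2 ^ i) powr \<eta> = (2 powr \<eta>) ^ i"
      by (simp add: powr_powr mult.commute flip: powr_realpow)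
    ultimately show ?thesis by (simp add: powr_mult)
  qed
  have "\<forall>\<^sub>F i in sequentially. norm (zero_count f (2 ^ i) / y ^ i)
      \<le> (6 powr \<eta> * (1 / sqrt y) ^ i - ln (norm (f p)) * (1 / y) ^ i) / ln 2"
    using ev
  proof eventually_elim
    case (elim i)
    have le: "2 ^ zero_count f (2 ^ i) \<le> max_modulus (6 * 2 ^ i) f / norm (f p)"
      by (rule two_power_zero_count_le[OF f p]) simp
    then have pos: "max_modulus (6 * 2 ^ i) f > 0"
      using p by (smt (verit) divide_nonpos_nonneg norm_ge_zero zero_less_power)
    have "ln (2 ^ zero_count f (2 ^ i)) \<le> ln (max_modulus (6 * 2 ^ i) f / norm (f p))"
      using le by (intro ln_mono) auto
    then have "zero_count f (2 ^ i) * ln 2 \<le> 6 powr \<eta> * sqrt y ^ i - ln (norm (f p))"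
      using elim pos p by (simp add: ln_realpow ln_div pw)
    then have "zero_count f (2 ^ i) \<le> (6 powr \<eta> * sqrt y ^ i - ln (norm (f p))) / ln 2"
      by (simp add: pos_le_divide_eq)
    then have "zero_count f (2 ^ i) / y ^ i \<le> (6 powr \<eta> * sqrt y ^ i - ln (norm (f p))) / ln 2 / y ^ i"
      using y by (intro divide_right_mono) auto
    also have "\<dots> = (6 powr \<eta> * (sqrt y ^ i / y ^ i) - ln (norm (f p)) * (1 / y) ^ i) / ln 2"
      by (simp add: power_one_over diff_divide_distrib mult.commute)
    also have "sqrt y ^ i / y ^ i = (1 / sqrt y) ^ i"
    proof -
      have "sqrt y / y = 1 / sqrt y" using y by (simp add: real_div_sqrt field_simps)
      then show ?thesis by (simp flip: power_divide)
    qed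
    finally show ?case using y by simp
  qed
  moreover have "(\<lambda>i. (6 powr \<eta> * (1 / sqrt y) ^ i - ln (norm (f p)) * (1 / y) ^ i) / ln 2) \<longlonglongrightarrow> 0"
  proof -
    have "(\<lambda>i. (6 powr \<eta> * (1 / sqrt y) ^ i - ln (norm (f p)) * (1 / y) ^ i) / ln 2)
        \<longlonglongrightarrow> (6 powr \<eta> * 0 - ln (norm (f p)) * 0) / ln 2"
      using y by (intro tendsto_intros LIMSEQ_realpow_zero) auto
    then show ?thesis by simp
  qed
  ultimately show ?thesis by (rule Lim_null_comparison)
qed

text \<open>A one-sided Polya peak: a sequence that is positive somewhere and tends to 0 attains its
  maximum from that index on.\<close>

lemma exists_peak:
  fixes n :: "nat \<Rightarrow> real"
  assumes "n J > 0" "y > 0" "(\<lambda>i. n i / y ^ i) \<longlonglongrightarrow> 0"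
  shows "\<exists>j\<ge>J. n j > 0 \<and> (\<forall>i\<ge>j. n i \<le> n j * y ^ (i - j))"
proof -
  define u where "u i = n i / y ^ i" for i
  have "u J > 0" using assms by (simp add: u_def)
  with assms(3) have "\<forall>\<^sub>F i in sequentially. u i < u J"
    unfolding u_def by (rule order_tendstoD(2))
  then obtain I where I: "\<And>i. i \<ge> I \<Longrightarrow> u i < u J" by (auto simp: eventually_sequentially)
  have ne: "finite (u ` {J..max I J})" "u ` {J..max I J} \<noteq> {}" by auto
  then obtain j where j: "j \<in> {J..max I J}" "u j = Max (u ` {J..max I J})"
    using Max_in[OF ne] by (metis imageE)
  have max: "u i \<le> u j" if "i \<ge> J" for i
  proof (cases "i \<le> max I J")
    case True
    then show ?thesis unfolding j(2) using that by (intro Max_ge) auto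
  next
    case False
    then have "u i < u J" using I by simp
    also have "u J \<le> u j" unfolding j(2) by (intro Max_ge) auto
    finally show ?thesis by simp
  qed
  have "u j > 0" using max[of J] \<open>u J > 0\<close> by simp
  then have "n j > 0" using assms(2) by (simp add: u_def zero_less_divide_iff)
  moreover have "n i \<le> n j * y ^ (i - j)" if "i \<ge> j" for i
    using max[of i] that j(1) assms(2) by (simp add: u_def field_simps power_diff)
  ultimately show ?thesis using j(1) by auto
qed

lemma sum_zeros_in_le:
  fixes w :: "complex \<Rightarrow> real"
  assumes f: "f holomorphic_on UNIV" "\<not> f constant_on UNIV" and "r \<le> R"
    and w: "\<And>a. r < norm a \<Longrightarrow> norm a \<le> R \<Longrightarrow> w a \<le> c"
  shows "(\<Sum>a\<in>zeros_in f R. zmult f a * w a)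
    \<le> (\<Sum>a\<in>zeros_in f r. zmult f a * w a) + c * (real (zero_count f R) - zero_count f r)"
proof -
  have sub: "zeros_in f r \<subseteq> zeros_in f R" using assms(3) by (auto simp: zeros_in_def)
  note diff = sum.subset_diff[OF sub finite_zeros_in[OF f]]
  have "(\<Sum>a\<in>zeros_in f R - zeros_in f r. zmult f a * w a) \<le> (\<Sum>a\<in>zeros_in f R - zeros_in f r. zmult f a * c)"
    by (intro sum_mono mult_left_mono w) (auto simp: zeros_in_def)
  also have "\<dots> = c * (real (zero_count f R) - zero_count f r)"
    unfolding zero_count_def diff[of "zmult f"] by (simp add: sum_distrib_left mult.commute)
  finally show ?thesis unfolding diff[of "\<lambda>a. zmult f a * w a"] by simp
qed

text \<open>The zeros fall into three groups. Up to \<open>2 ^ j\<close> the weight is at most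
  \<open>1 / 2 ^ k\<close>. From there to \<open>2 ^ (j + 2 * k)\<close> it is at most 1, and the
  peak leaves at most \<open>y ^ (2 * k) - 1\<close> times the peak count of zeros. In the dyadic
  annulus number \<open>t\<close> beyond, the weight is at most \<open>1 / 2 ^ (k + t)\<close> and
  the count at most \<open>y ^ (2 * k + 1 + t)\<close> times the peak count; as \<open>y / 2\<close>
  is at most 3/4, a geometric series results. The induction adds one annulus at a time.\<close>

lemma weighted_zero_sum_le:
  fixes y r :: real
  assumes f: "f holomorphic_on UNIV" "\<not> f constant_on UNIV"
    and y: "1 \<le> y" "y \<le> 3 / 2"
    and peak: "\<And>i. i \<ge> j \<Longrightarrow> real (zero_count f (2 ^ i)) \<le> zero_count f (2 ^ j) * y ^ (i - j)"
    and r: "r = 2 ^ (j + k)"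
  shows "(\<Sum>a\<in>zeros_in f (2 ^ (j + 2 * k + s)). zmult f a * min (norm a / r) (r / norm a))
    \<le> zero_count f (2 ^ j) * (1 / 2 ^ k + (y ^ (2 * k) - 1) + y ^ (2 * k + 1) / 2 ^ k * (\<Sum>t<s. (3 / 4) ^ t))"
proof (induction s)
  case 0
  let ?w = "\<lambda>a::complex. min (norm a / r) (r / norm a)"
  have "r > 0" by (simp add: r)
  have "(\<Sum>a\<in>zeros_in f (2 ^ (j + 2 * k)). zmult f a * ?w a)
      \<le> (\<Sum>a\<in>zeros_in f (2 ^ j). zmult f a * ?w a) + 1 * (real (zero_count f (2 ^ (j + 2 * k))) - zero_count f (2 ^ j))"
    by (rule sum_zeros_in_le[OF f]) (use \<open>r > 0\<close> in \<open>auto simp: min_le_iff_disj divide_le_eq\<close>)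
  also have "(\<Sum>a\<in>zeros_in f (2 ^ j). zmult f a * ?w a) \<le> (\<Sum>a\<in>zeros_in f (2 ^ j). zmult f a * (1 / 2 ^ k))"
  proof (intro sum_mono mult_left_mono)
    fix a assume "a \<in> zeros_in f (2 ^ j)"
    then have "norm a / r \<le> 2 ^ j / r" using \<open>r > 0\<close> by (intro divide_right_mono) (auto simp: zeros_in_def)
    also have "\<dots> = 1 / 2 ^ k" by (simp add: r power_add)
    finally show "?w a \<le> 1 / 2 ^ k" by simp
  qed simp
  also have "\<dots> = zero_count f (2 ^ j) * (1 / 2 ^ k)"
    by (simp only: zero_count_def of_nat_sum sum_distrib_right)
  also have "real (zero_count f (2 ^ (j + 2 * k))) \<le> zero_count f (2 ^ j) * y ^ (2 * k)"
    using peak[of "j + 2 * k"] by simp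
  finally show ?case by (simp add: algebra_simps)
next
  case (Suc s)
  let ?w = "\<lambda>a::complex. min (norm a / r) (r / norm a)"
  let ?N = "real (zero_count f (2 ^ j))"
  have "r > 0" by (simp add: r)
  define T where "T = (2::real) ^ (j + 2 * k + s)"
  let ?A = "1 / 2 ^ k + (y ^ (2 * k) - 1)" and ?B = "y ^ (2 * k + 1) / 2 ^ k"
  have "(\<Sum>a\<in>zeros_in f (2 * T). zmult f a * ?w a)
      \<le> (\<Sum>a\<in>zeros_in f T. zmult f a * ?w a) + r / T * (real (zero_count f (2 * T)) - zero_count f T)"
  proof (rule sum_zeros_in_le[OF f])
    fix a :: complex assume a: "T < norm a" "norm a \<le> 2 * T"
    have "T > 0" by (simp add: T_def)
    then have "r / norm a \<le> r / T" using a \<open>r > 0\<close> by (intro frac_le) auto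
    then show "?w a \<le> r / T" by simp
  qed (simp add: T_def)
  also have "\<dots> \<le> (\<Sum>a\<in>zeros_in f T. zmult f a * ?w a) + r / T * real (zero_count f (2 * T))"
    using \<open>r > 0\<close> by (intro add_mono mult_left_mono) (auto simp: T_def)
  finally have 1: "(\<Sum>a\<in>zeros_in f (2 * T). zmult f a * ?w a)
      \<le> (\<Sum>a\<in>zeros_in f T. zmult f a * ?w a) + r / T * real (zero_count f (2 * T))" .
  have "r / T * real (zero_count f (2 * T)) \<le> r / T * (?N * (y ^ (2 * k + 1) * y ^ s))"
    using peak[of "j + 2 * k + s + 1"] \<open>r > 0\<close>
    by (intro mult_left_mono) (auto simp: T_def power_add mult_ac)
  also have "r / T * (?N * (y ^ (2 * k + 1) * y ^ s)) = ?N * ?B * (y / 2) ^ s"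
  proof -
    have "r / T = 1 / 2 ^ k / 2 ^ s" by (simp add: r T_def power_add mult_2)
    then show ?thesis by (simp add: power_divide)
  qed
  also have "\<dots> \<le> ?N * ?B * (3 / 4) ^ s"
    using y by (intro mult_left_mono power_mono) auto
  finally have 2: "r / T * real (zero_count f (2 * T)) \<le> ?N * ?B * (3 / 4) ^ s" .
  have "?N * (?A + ?B * (\<Sum>t<Suc s. (3 / 4) ^ t))
      = ?N * (?A + ?B * (\<Sum>t<s. (3 / 4) ^ t)) + ?N * ?B * (3 / 4) ^ s"
    by (simp only: sum.lessThan_Suc distrib_left mult.assoc add.assoc)
  moreover have "2 ^ (j + 2 * k + Suc s) = 2 * T" by (simp add: T_def)
  ultimately show ?case
    using 1 2 Suc.IH unfolding T_def[symmetric] by simp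
qed

text \<open>First \<open>k\<close> is chosen, to make the weights small on both sides of the annulus
  between \<open>2 ^ j\<close> and \<open>2 ^ (j + 2 * k)\<close>; then \<open>y\<close> close to 1
  depending on \<open>k\<close>, so that this annulus holds few zeros; last the peak
  \<open>j\<close>. The radius is the geometric mean of the two bounding radii.\<close>

lemma exists_peak_radius:
  fixes \<delta> R\<^sub>0 :: real
  assumes f: "f holomorphic_on UNIV" "\<not> f constant_on UNIV" and order: "entire_order f = 0"
    and \<delta>: "\<delta> > 0"
  shows "\<exists>r>R\<^sub>0. r > 0 \<and> zero_count f r \<ge> 1 \<and>
    (\<forall>R. (\<Sum>a\<in>zeros_in f R. zmult f a * min (norm a / r) (r / norm a)) \<le> \<delta> * zero_count f r)"
proof -
  \<comment> \<open>The inner and outer groups contribute \<open>13 / 2 ^ k\<close> in total, where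
    13 = 1 + 3 * 4, and this is to stay below \<open>\<delta> / 2\<close>.\<close>
  obtain k where k: "(1 / 2) ^ k < \<delta> / 26"
    using real_arch_pow_inv[of "\<delta> / 26" "1 / 2"] \<delta> by auto
  have "((\<lambda>y::real. y ^ (2 * k)) \<longlongrightarrow> 1 ^ (2 * k)) (at_right 1)"
    "((\<lambda>y::real. y ^ (2 * k + 1)) \<longlongrightarrow> 1 ^ (2 * k + 1)) (at_right 1)"
    by (intro tendsto_intros)+
  then have "\<forall>\<^sub>F y::real in at_right 1. y ^ (2 * k) < 1 + \<delta> / 2"
    "\<forall>\<^sub>F y::real in at_right 1. y ^ (2 * k + 1) < 3"
    using \<delta> by (auto intro: order_tendstoD(2))
  moreover have "\<forall>\<^sub>F y::real in at_right 1. y \<in> {1<..<3 / 2}"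
    by (rule eventually_at_right_real) simp
  ultimately have "\<forall>\<^sub>F y::real in at_right 1. y ^ (2 * k) < 1 + \<delta> / 2 \<and> y ^ (2 * k + 1) < 3 \<and> y \<in> {1<..<3 / 2}"
    by eventually_elim auto
  then obtain y :: real where y: "y ^ (2 * k) < 1 + \<delta> / 2" "y ^ (2 * k + 1) < 3" "1 < y" "y < 3 / 2"
    by (auto dest!: eventually_happens)
  obtain a where "f a = 0" using order_zero_has_zero[OF f order] by blast
  \<comment> \<open>From the exponent \<open>J\<close> on, radii exceed \<open>R\<^sub>0\<close> and
    discs contain a zero.\<close>
  obtain J where J: "max R\<^sub>0 (norm a) < 2 ^ J"
    using real_arch_pow[of 2 "max R\<^sub>0 (norm a)"] by auto
  define n where "n i = real (zero_count f (2 ^ i))" for i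
  have "n J > 0"
    using zero_count_pos[OF f, of a "2 ^ J"] J \<open>f a = 0\<close> by (simp add: n_def zeros_in_def)
  moreover have "(\<lambda>i. n i / y ^ i) \<longlonglongrightarrow> 0"
    unfolding n_def by (rule zero_count_subexponential[OF f order y(3)])
  ultimately obtain j where j: "j \<ge> J" "n j > 0" "\<And>i. i \<ge> j \<Longrightarrow> n i \<le> n j * y ^ (i - j)"
    using exists_peak[of n J y] y by auto
  define r where "r = (2::real) ^ (j + k)"
  have mono: "(2::real) ^ J \<le> r" "(2::real) ^ j \<le> r"
    unfolding r_def using j(1) by (auto intro!: power_increasing)
  have njr: "n j \<le> zero_count f r"
    unfolding n_def using zero_count_mono[OF f mono(2)] by simp
  have "(\<Sum>a\<in>zeros_in f R. zmult f a * min (norm a / r) (r / norm a)) \<le> \<delta> * zero_count f r" for R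
  proof -
    obtain s where s: "R < 2 ^ s" using real_arch_pow[of 2 R] by auto
    have "R \<le> 2 ^ (j + 2 * k + s)"
    proof -
      have "(2::real) ^ s \<le> 2 ^ (j + 2 * k + s)" by (intro power_increasing) auto
      then show ?thesis using s by linarith
    qed
    then have "zeros_in f R \<subseteq> zeros_in f (2 ^ (j + 2 * k + s))" by (auto simp: zeros_in_def)
    then have "(\<Sum>a\<in>zeros_in f R. zmult f a * min (norm a / r) (r / norm a))
        \<le> (\<Sum>a\<in>zeros_in f (2 ^ (j + 2 * k + s)). zmult f a * min (norm a / r) (r / norm a))"
      by (intro sum_mono2 finite_zeros_in[OF f]) (auto simp: r_def)
    also have "\<dots> \<le> n j * (1 / 2 ^ k + (y ^ (2 * k) - 1) + y ^ (2 * k + 1) / 2 ^ k * (\<Sum>t<s. (3 / 4) ^ t))"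
      unfolding n_def by (rule weighted_zero_sum_le[OF f]) (use y j in \<open>auto simp: n_def r_def\<close>)
    also have "\<dots> \<le> n j * (1 / 2 ^ k + \<delta> / 2 + 3 / 2 ^ k * 4)"
    proof (intro mult_left_mono add_mono mult_mono divide_right_mono)
      show "(\<Sum>t<s. (3 / 4) ^ t) \<le> (4::real)" by (simp add: sum_gp_strict)
    qed (use y j in \<open>auto intro!: sum_nonneg\<close>)
    also have "\<dots> \<le> n j * \<delta>"
      using k j by (intro mult_left_mono) (auto simp: power_one_over)
    also have "\<dots> \<le> \<delta> * zero_count f r"
      using njr \<delta> by (simp add: mult.commute)
    finally show ?thesis .
  qed
  moreover have "r > R\<^sub>0" using J mono by simp
  moreover have "zero_count f r \<ge> 1" using njr j(2) by linarith
  moreover have "r > 0" by (simp add: r_def)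
  ultimately show ?thesis by blast
qed

subsection \<open>Equidistribution\<close>

text \<open>\<open>z / (z - a)\<close> is near 1 for small \<open>a\<close> and near 0 for large
  \<open>a\<close>. If \<open>a\<close> is in the closed disc, the difference is
  \<open>a / (z - a)\<close>; if it is slightly outside, the pole is integrated, the minimum being
  at least 1/2; if \<open>norm a\<close> is at least \<open>2 * r\<close>, the quotient is at most
  \<open>2 * r / norm a\<close>.\<close>

lemma pole_term_bound:
  fixes a :: complex
  assumes r: "r > 0"
  shows "\<exists>b. integrable lborel b \<and>
    (\<integral>z. b z \<partial>lborel) \<le> 10 * pi * r\<^sup>2 * min (norm a / r) (r / norm a) \<and>
    (\<forall>z. z \<noteq> a \<longrightarrow>
      indicator (ball 0 r) z * norm (z / (z - a) - (if norm a \<le> r then 1 else 0)) \<le> b z)"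
proof -
  note int = integrable_inverse_dist_disc[OF r, of a]
  let ?d = "\<lambda>z. indicator (ball 0 r) z / dist z a"
  consider "norm a \<le> r" | "r < norm a" "norm a < 2 * r" | "2 * r \<le> norm a" by linarith
  then show ?thesis
  proof cases
    case 1
    have m: "min (norm a / r) (r / norm a) = norm a / r"
    \<comment> \<open>For \<open>a = 0\<close> both quotients are 0, the second one as a division by
      zero.\<close>
    proof (cases "a = 0")
      case False
      then have "norm a / r \<le> 1" "1 \<le> r / norm a" using 1 r by auto
      then show ?thesis by linarith
    qed simp
    have "(\<integral>z. norm a * ?d z \<partial>lborel) = norm a * (\<integral>z. ?d z \<partial>lborel)"
      by (rule integral_mult_right_zero)
    also have "\<dots> \<le> norm a * (5 * pi * r)" by (intro mult_left_mono int) simp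
    also have "\<dots> \<le> 10 * pi * r\<^sup>2 * (norm a / r)"
      using r by (simp add: power2_eq_square)
    finally have "(\<integral>z. norm a * ?d z \<partial>lborel) \<le> 10 * pi * r\<^sup>2 * min (norm a / r) (r / norm a)"
      by (simp only: m)
    moreover have "indicator (ball 0 r) z * norm (z / (z - a) - (if norm a \<le> r then 1 else 0))
        \<le> norm a * ?d z" if "z \<noteq> a" for z
    proof -
      have "z / (z - a) - 1 = a / (z - a)" using that by (simp add: field_simps)
      then show ?thesis using 1 by (simp add: norm_divide dist_norm mult.commute)
    qed
    ultimately show ?thesis using integrable_mult_right[of "norm a", OF int(1)]
      by (intro exI[of _ "\<lambda>z. norm a * ?d z"]) blast
  next
    case 2
    have m: "1 / 2 \<le> min (norm a / r) (r / norm a)" 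
    proof -
      have "norm a > 0" using 2 r by linarith
      then have "a \<noteq> 0" by simp
      then show ?thesis using 2 r by (simp add: le_divide_eq)
    qed
    have "(\<integral>z. r * ?d z \<partial>lborel) = r * (\<integral>z. ?d z \<partial>lborel)"
      by (rule integral_mult_right_zero)
    also have "\<dots> \<le> r * (5 * pi * r)" using r by (intro mult_left_mono int) simp
    also have "\<dots> = 10 * pi * r\<^sup>2 * (1 / 2)" by (simp add: power2_eq_square)
    also have "\<dots> \<le> 10 * pi * r\<^sup>2 * min (norm a / r) (r / norm a)"
      by (intro mult_left_mono m) simp
    finally have "(\<integral>z. r * ?d z \<partial>lborel) \<le> 10 * pi * r\<^sup>2 * min (norm a / r) (r / norm a)" .
    moreover have "indicator (ball 0 r) z * norm (z / (z - a) - (if norm a \<le> r then 1 else 0))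
        \<le> r * ?d z" for z
      using 2 by (auto simp: indicator_def norm_divide dist_norm intro!: divide_right_mono)
    ultimately show ?thesis using integrable_mult_right[of "r", OF int(1)]
      by (intro exI[of _ "\<lambda>z. r * ?d z"]) blast
  next
    case 3
    then have m: "min (norm a / r) (r / norm a) = r / norm a"
    proof -
      have "r / norm a \<le> 1" "1 \<le> norm a / r" using 3 r by (auto simp: divide_le_eq)
      then show ?thesis by linarith
    qed
    have "integrable lborel (indicator (ball 0 r) :: complex \<Rightarrow> real)"
      by (intro integrable_real_indicator) (auto simp: emeasure_lborel_disc r less_imp_le)
    from integrable_mult_right[of "2 * r / norm a", OF this]
    have "integrable lborel (\<lambda>z::complex. 2 * r / norm a * indicator (ball 0 r) z)" .
    moreover have "(\<integral>z. 2 * r / norm a * indicator (ball (0::complex) r) z \<partial>lborel)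
        \<le> 10 * pi * r\<^sup>2 * min (norm a / r) (r / norm a)"
    proof -
      have "(\<integral>z. 2 * r / norm a * indicator (ball (0::complex) r) z \<partial>lborel)
          = 2 * r / norm a * (\<integral>z. indicator (ball (0::complex) r) z \<partial>lborel)"
        by (rule integral_mult_right_zero)
      also have "(\<integral>z. indicator (ball (0::complex) r) z \<partial>lborel) = pi * r\<^sup>2"
        using measure_lborel_disc[of r 0] r by simp
      also have "2 * r / norm a * (pi * r\<^sup>2) \<le> 10 * pi * r\<^sup>2 * (r / norm a)"
        using r by (simp add: divide_right_mono)
      finally show ?thesis by (simp only: m)
    qed
    moreover have "indicator (ball 0 r) z * norm (z / (z - a) - (if norm a \<le> r then 1 else 0))
        \<le> 2 * r / norm a * indicator (ball 0 r) z" for z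
    proof (cases "z \<in> ball 0 r")
      case True
      have "norm a / 2 \<le> norm (z - a)"
        using True 3 norm_triangle_ineq2[of a z] by (simp add: norm_minus_commute)
      moreover have "norm a > 0" using 3 r by linarith
      ultimately have "norm (z / (z - a)) \<le> r / (norm a / 2)"
        unfolding norm_divide using True r by (intro frac_le) auto
      then show ?thesis using True 3 r by (simp add: mult.commute)
    qed simp
    ultimately show ?thesis
      by (intro exI[of _ "\<lambda>z. 2 * r / norm a * indicator (ball 0 r) z"]) blast
  qed
qed

lemma borel_measurable_entire:
  assumes "f holomorphic_on UNIV"
  shows "f \<in> borel_measurable borel" "deriv f \<in> borel_measurable borel"
  using assms holomorphic_deriv[OF assms open_UNIV]
  by (auto intro!: borel_measurable_continuous_onI holomorphic_on_imp_continuous_on)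

text \<open>The zero count is distributed over the zeros, 1 for each zero in the closed disc, and
  every pole term is compared with its share. The remaining error of the approximation is at most
  \<open>r * \<delta>\<close> on an area of \<open>pi * r\<^sup>2\<close>.\<close>

lemma integral_logderiv_deviation:
  fixes \<delta> r R :: real
  assumes f: "f holomorphic_on UNIV" "\<not> f constant_on UNIV" and r: "0 < r" "r \<le> R"
    and approx: "\<And>z. norm z < r \<Longrightarrow> f z \<noteq> 0 \<Longrightarrow>
      norm (deriv f z / f z - (\<Sum>a\<in>zeros_in f R. of_nat (zmult f a) / (z - a))) \<le> \<delta>"
  defines "D \<equiv> \<lambda>z. indicator (ball 0 r) z * norm (z * deriv f z / f z - of_nat (zero_count f r))"
  shows "integrable lborel D"
    and "(\<integral>z. D z \<partial>lborel) \<le> \<delta> * pi * r ^ 3 +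
      10 * pi * r\<^sup>2 * (\<Sum>a\<in>zeros_in f R. zmult f a * min (norm a / r) (r / norm a))"
proof -
  note [measurable] = borel_measurable_entire[OF f(1)]
  let ?Z = "zeros_in f R"
  have finZ: "finite ?Z" by (rule finite_zeros_in[OF f])
  have "\<forall>a::complex. \<exists>b. integrable lborel b \<and>
    (\<integral>z. b z \<partial>lborel) \<le> 10 * pi * r\<^sup>2 * min (norm a / r) (r / norm a) \<and>
    (\<forall>z. z \<noteq> a \<longrightarrow>
      indicator (ball 0 r) z * norm (z / (z - a) - (if norm a \<le> r then 1 else 0)) \<le> b z)"
    by (intro allI pole_term_bound r)
  from choice[OF this] obtain b where b': "\<forall>a::complex. integrable lborel (b a) \<and>
    (\<integral>z. b a z \<partial>lborel) \<le> 10 * pi * r\<^sup>2 * min (norm a / r) (r / norm a) \<and>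
    (\<forall>z. z \<noteq> a \<longrightarrow>
      indicator (ball 0 r) z * norm (z / (z - a) - (if norm a \<le> r then 1 else 0)) \<le> b a z)" ..
  have b: "\<And>a::complex. integrable lborel (b a)"
    "\<And>a::complex. (\<integral>z. b a z \<partial>lborel) \<le> 10 * pi * r\<^sup>2 * min (norm a / r) (r / norm a)"
    "\<And>(a::complex) z. z \<noteq> a \<Longrightarrow>
      indicator (ball 0 r) z * norm (z / (z - a) - (if norm a \<le> r then 1 else 0)) \<le> b a z"
    using b' by blast+
  define G where "G z = \<delta> * r * indicator (ball 0 r) z + (\<Sum>a\<in>?Z. zmult f a * b a z)" for z
  have indi: "integrable lborel (indicator (ball 0 r) :: complex \<Rightarrow> real)"
    using r by (intro integrable_real_indicator) (auto simp: emeasure_lborel_disc)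
  have Gi: "integrable lborel G"
    unfolding G_def using indi b(1) by (intro Bochner_Integration.integrable_add Bochner_Integration.integrable_sum integrable_mult_right)
  have Dm: "D \<in> borel_measurable lborel"
    unfolding D_def by (intro borel_measurable_times borel_measurable_indicator) auto
  have count: "zero_count f r = (\<Sum>a\<in>?Z. zmult f a * (if norm a \<le> r then 1 else 0))"
  proof -
    have "zeros_in f r = {a \<in> ?Z. norm a \<le> r}" using r by (auto simp: zeros_in_def)
    then show ?thesis
      unfolding zero_count_def using finZ by (simp add: sum.inter_filter[symmetric] if_distrib cong: if_cong)
  qed
  have le: "D z \<le> G z" if z: "z \<notin> ?Z" for z
  proof (cases "z \<in> ball 0 r")
    case True
    then have fz: "f z \<noteq> 0" "norm z < r" using z r by (auto simp: zeros_in_def)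
    have "of_nat (zero_count f r) = (\<Sum>a\<in>?Z. of_nat (zmult f a) * (if norm a \<le> r then 1 else 0 :: complex))"
      unfolding count of_nat_sum by (intro sum.cong) auto
    then have eq: "z * deriv f z / f z - of_nat (zero_count f r)
        = z * (deriv f z / f z - (\<Sum>a\<in>?Z. of_nat (zmult f a) / (z - a)))
        + (\<Sum>a\<in>?Z. of_nat (zmult f a) * (z / (z - a) - (if norm a \<le> r then 1 else 0)))"
      by (simp add: right_diff_distrib sum_subtractf sum_distrib_left mult_ac)
    have "norm (z * deriv f z / f z - of_nat (zero_count f r)) \<le> r * \<delta> + (\<Sum>a\<in>?Z. zmult f a * b a z)"
      unfolding eq
    proof (rule norm_triangle_mono)
      show "norm (z * (deriv f z / f z - (\<Sum>a\<in>?Z. of_nat (zmult f a) / (z - a)))) \<le> r * \<delta>"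
        unfolding norm_mult using fz r approx[OF fz(2,1)] by (intro mult_mono) auto
      show "norm (\<Sum>a\<in>?Z. of_nat (zmult f a) * (z / (z - a) - (if norm a \<le> r then 1 else 0)))
          \<le> (\<Sum>a\<in>?Z. zmult f a * b a z)"
      proof (rule sum_norm_le)
        fix a assume "a \<in> ?Z"
        then have "z \<noteq> a" using z by auto
        from b(3)[OF this] True
        show "norm (of_nat (zmult f a) * (z / (z - a) - (if norm a \<le> r then 1 else 0))) \<le> zmult f a * b a z"
          unfolding norm_mult norm_of_nat by (intro mult_left_mono) auto
      qed
    qed
    moreover have "G z = r * \<delta> + (\<Sum>a\<in>?Z. zmult f a * b a z)"
      using True by (simp add: G_def)
    moreover have "D z = norm (z * deriv f z / f z - of_nat (zero_count f r))"
      using True by (simp add: D_def)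
    ultimately show ?thesis by (simp only:)
  next
    case False
    have "0 \<le> b a z" if "a \<in> ?Z" for a
      using b(3)[of z a] z that False by auto
    then show ?thesis using False by (auto simp: D_def G_def intro!: sum_nonneg)
  qed
  have "?Z \<in> null_sets lborel" using finZ by (rule finite_imp_null_set_lborel)
  then have AEle: "AE z in lborel. D z \<le> G z"
    by (rule AE_I'[of ?Z]) (use le in auto)
  have D0: "D z \<ge> 0" for z by (simp add: D_def)
  show Di: "integrable lborel D"
    using Gi Dm by (rule Bochner_Integration.integrable_bound) (use AEle D0 in \<open>auto elim!: eventually_mono intro: order_trans\<close>)
  have "(\<integral>z. D z \<partial>lborel) \<le> (\<integral>z. G z \<partial>lborel)"
    by (rule integral_mono_AE[OF Di Gi AEle])
  also have "\<dots> = \<delta> * r * (pi * r\<^sup>2) + (\<Sum>a\<in>?Z. zmult f a * (\<integral>z. b a z \<partial>lborel))"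
    unfolding G_def using indi b(1) r by (simp add: measure_lborel_disc)
  also have "\<dots> \<le> \<delta> * r * (pi * r\<^sup>2) + (\<Sum>a\<in>?Z. zmult f a * (10 * pi * r\<^sup>2 * min (norm a / r) (r / norm a)))"
    by (intro add_left_mono sum_mono mult_left_mono b) auto
  also have "\<dots> = \<delta> * pi * r ^ 3 + 10 * pi * r\<^sup>2 * (\<Sum>a\<in>?Z. zmult f a * min (norm a / r) (r / norm a))"
    by (simp add: sum_distrib_left power2_eq_square power3_eq_cube mult_ac)
  finally show "(\<integral>z. D z \<partial>lborel) \<le> \<delta> * pi * r ^ 3 +
      10 * pi * r\<^sup>2 * (\<Sum>a\<in>?Z. zmult f a * min (norm a / r) (r / norm a))" .
qed

text \<open>There are only countably many zeros, and the circle through each of them is a null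
  set.\<close>

lemma AE_circle_zero_free:
  assumes f: "f holomorphic_on UNIV" "\<not> f constant_on UNIV"
  shows "AE z::complex in lborel. \<forall>w. norm w = norm z \<longrightarrow> f w \<noteq> 0"
proof -
  have "{a. f a = 0} = (\<Union>n::nat. zeros_in f n)"
    by (auto simp: zeros_in_def real_arch_simple)
  moreover have "countable (\<Union>n::nat. zeros_in f n)"
    by (rule countable_UN) (auto intro: countable_finite finite_zeros_in[OF f])
  ultimately have "countable {a. f a = 0}" by (simp only:)
  moreover have "sphere (0::complex) (norm a) \<in> null_sets lborel" for a :: complex
  proof -
    have "sphere (0::complex) (norm a) \<in> null_sets lebesgue"
      using negligible_sphere[of "0::complex" "norm a"] by (simp add: negligible_iff_null_sets)
    then show ?thesis by (simp add: null_sets_completion_iff)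
  qed
  ultimately have "(\<Union>a\<in>{a. f a = 0}. sphere (0::complex) (norm a)) \<in> null_sets lborel"
    by (intro null_sets_UN')
  then show ?thesis
    by (rule AE_I') auto
qed

text \<open>With \<open>g\<close> of mean zero against \<open>Re F\<close> on almost every circle,
  the integral of \<open>N * g\<close> is minus that of \<open>(Re F - N) * g\<close>, and
  \<open>g\<close> is bounded by 1.\<close>

lemma sector_area_deviation:
  fixes N :: real
  assumes f: "f holomorphic_on UNIV" "\<not> f constant_on UNIV" and r: "0 < r" and N: "N \<ge> 0"
    and \<alpha>: "0 < \<alpha>" "\<alpha> \<le> 2 * pi"
    and int: "integrable lborel (\<lambda>z. indicator (ball 0 r) z * norm (z * deriv f z / f z - of_real N))"
  shows "N * \<bar>measure lborel (f -` sector \<beta> (\<beta> + \<alpha>) \<inter> ball 0 r) - \<alpha> / (2 * pi) * (pi * r\<^sup>2)\<bar>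
    \<le> (\<integral>z. indicator (ball 0 r) z * norm (z * deriv f z / f z - of_real N) \<partial>lborel)"
proof -
  note [measurable] = borel_measurable_entire[OF f(1)] sets_sector[OF \<alpha>, of \<beta>]
  let ?S = "sector \<beta> (\<beta> + \<alpha>)"
  define F where "F z = z * deriv f z / f z" for z
  define ind :: "complex \<Rightarrow> real" where "ind = indicator (ball 0 r)"
  define g where "g z = indicator ?S (f z) - \<alpha> / (2 * pi)" for z
  have gm [measurable]: "g \<in> borel_measurable borel" "F \<in> borel_measurable borel" "ind \<in> borel_measurable borel"
    unfolding g_def F_def ind_def by (measurable, auto intro: borel_measurable_indicator)
  have \<alpha>': "0 < \<alpha> / (2 * pi)" "\<alpha> / (2 * pi) \<le> 1" using \<alpha> by (auto simp: divide_le_eq)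
  have g1: "\<bar>g z\<bar> \<le> 1" for z
  proof -
    have "0 \<le> (indicator ?S (f z) :: real)" "(indicator ?S (f z) :: real) \<le> 1" by simp_all
    with \<alpha>' show ?thesis unfolding g_def by linarith
  qed
  have indi: "integrable lborel ind"
    unfolding ind_def using r by (intro integrable_real_indicator) (auto simp: emeasure_lborel_disc)
  have Di: "integrable lborel (\<lambda>z. ind z * norm (F z - of_real N))"
    using int by (simp add: F_def ind_def)
  have i1: "integrable lborel (\<lambda>z. ind z * (Re (F z) - N) * g z)"
  proof (rule Bochner_Integration.integrable_bound[OF Di])
    have "\<bar>ind z * (Re (F z) - N) * g z\<bar> \<le> ind z * norm (F z - of_real N)" for z
      using abs_Re_le_cmod[of "F z - of_real N"] mult_mono[OF _ g1[of z], of "\<bar>Re (F z) - N\<bar>" "norm (F z - of_real N)"]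
      by (auto simp: abs_mult ind_def indicator_def)
    then show "AE z in lborel. norm (ind z * (Re (F z) - N) * g z) \<le> norm (ind z * norm (F z - of_real N))"
      by (auto simp: ind_def)
  qed measurable
  have i2: "integrable lborel (\<lambda>z. ind z * g z)"
    by (rule Bochner_Integration.integrable_bound[OF indi])
      (use g1 in \<open>auto simp: abs_mult ind_def indicator_def\<close>)
  \<comment> \<open>\<open>F\<close> has poles at the zeros of \<open>f\<close>; integrability is
    inherited from the assumed integrability of \<open>F - N\<close>.\<close>
  have "(\<lambda>z. ind z * Re (F z) * g z) = (\<lambda>z. ind z * (Re (F z) - N) * g z + N * (ind z * g z))"
    by (auto simp: algebra_simps)
  then have i3: "integrable lborel (\<lambda>z. ind z * Re (F z) * g z)"
    and sum: "(\<integral>z. ind z * Re (F z) * g z \<partial>lborel)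
      = (\<integral>z. ind z * (Re (F z) - N) * g z \<partial>lborel) + N * (\<integral>z. ind z * g z \<partial>lborel)"
    using i1 i2 by simp_all
  have "(\<integral>z. ind z * Re (F z) * g z \<partial>lborel) = 0"
  proof (rule integral_eq_0_if_circle_integrals_eq_0[OF i3])
    show "AE z in lborel. ((\<lambda>\<theta>. ind (cis \<theta> * z) * Re (F (cis \<theta> * z)) * g (cis \<theta> * z)) has_integral 0) {0..2 * pi}"
      using AE_circle_zero_free[OF f]
    proof eventually_elim
      case (elim z)
      have "((\<lambda>\<theta>. Re (F (cis \<theta> * z)) * g (cis \<theta> * z)) has_integral 0) {0..2 * pi}"
        unfolding F_def g_def using elim by (intro circle_sector_integral f \<alpha>) auto
      \<comment> \<open>The disc indicator depends on the modulus only and is constant along the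
        circle.\<close>
      from has_integral_mult_right[OF this, of "ind z"]
      show ?case by (simp add: ind_def indicator_def norm_mult mult.assoc)
    qed
  qed
  then have "N * (\<integral>z. ind z * g z \<partial>lborel) = - (\<integral>z. ind z * (Re (F z) - N) * g z \<partial>lborel)"
    using sum by simp
  moreover have "(\<integral>z. ind z * g z \<partial>lborel) = measure lborel (f -` ?S \<inter> ball 0 r) - \<alpha> / (2 * pi) * (pi * r\<^sup>2)"
  proof -
    have "f -` ?S \<inter> ball 0 r \<in> sets borel"
      using measurable_sets[of f borel borel ?S] by auto
    moreover have "emeasure lborel (f -` ?S \<inter> ball 0 r) < \<infinity>"
      by (intro emeasure_bounded_finite bounded_Int) auto
    ultimately have "integrable lborel (indicator (f -` ?S \<inter> ball 0 r) :: complex \<Rightarrow> real)"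
      by (intro integrable_real_indicator) auto
    moreover have "(\<lambda>z. ind z * g z) = (\<lambda>z. indicator (f -` ?S \<inter> ball 0 r) z - \<alpha> / (2 * pi) * ind z)"
      by (auto simp: ind_def g_def indicator_def algebra_simps)
    ultimately show ?thesis
      using indi r by (simp add: ind_def measure_lborel_disc)
  qed
  ultimately have "N * \<bar>measure lborel (f -` ?S \<inter> ball 0 r) - \<alpha> / (2 * pi) * (pi * r\<^sup>2)\<bar>
      = \<bar>\<integral>z. ind z * (Re (F z) - N) * g z \<partial>lborel\<bar>"
    using N by (metis abs_minus_cancel abs_mult abs_of_nonneg)
  also have "\<dots> \<le> (\<integral>z. \<bar>ind z * (Re (F z) - N) * g z\<bar> \<partial>lborel)"
    by (rule integral_abs_bound)
  also have "\<dots> \<le> (\<integral>z. ind z * norm (F z - of_real N) \<partial>lborel)"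
  proof (rule integral_mono)
    show "\<bar>ind z * (Re (F z) - N) * g z\<bar> \<le> ind z * norm (F z - of_real N)" for z
      using abs_Re_le_cmod[of "F z - of_real N"] mult_mono[OF _ g1[of z], of "\<bar>Re (F z) - N\<bar>" "norm (F z - of_real N)"]
      by (auto simp: abs_mult ind_def indicator_def)
  qed (use i1 Di in auto)
  finally show ?thesis by (simp add: ind_def F_def)
qed

theorem theorem1p2:
  fixes f :: "complex \<Rightarrow> complex" and \<epsilon> :: real
  assumes entire: "f holomorphic_on UNIV"
    and nonconstant: "\<not> f constant_on UNIV"
    and order_zero: "entire_order f = 0"
    and eps: "\<epsilon> > 0"
  shows "\<forall>R::real. \<exists>r>R. \<forall>\<theta>\<^sub>1 \<theta>\<^sub>2 \<alpha>. \<alpha> = \<theta>\<^sub>2 - \<theta>\<^sub>1 \<and> 0 < \<alpha> \<and> \<alpha> \<le> 2 * pi \<longrightarrow>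
    (\<alpha> - \<epsilon>) / (2 * pi) \<le> relative_area r (sector \<theta>\<^sub>1 \<theta>\<^sub>2) f \<and>
    relative_area r (sector \<theta>\<^sub>1 \<theta>\<^sub>2) f \<le> (\<alpha> + \<epsilon>) / (2 * pi)"
proof
  fix R\<^sub>0 :: real
  note f = entire nonconstant
  \<comment> \<open>With the factor \<open>10 * pi * r\<^sup>2\<close> of the deviation bound this
    yields \<open>\<epsilon> / 4 * r\<^sup>2 * N\<close>, half of the permitted error.\<close>
  have "\<epsilon> / (40 * pi) > 0" using eps by simp
  then obtain r where r: "r > R\<^sub>0" "r > 0" "zero_count f r \<ge> 1"
    and sum_le: "\<And>R. (\<Sum>a\<in>zeros_in f R. zmult f a * min (norm a / r) (r / norm a)) \<le> \<epsilon> / (40 * pi) * zero_count f r"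
    using exists_peak_radius[OF f order_zero, of "\<epsilon> / (40 * pi)" R\<^sub>0] by auto
  define N where "N = real (zero_count f r)"
  have N: "N \<ge> 1" using r by (simp add: N_def)
  \<comment> \<open>The tolerance for the other half depends on \<open>r\<close>, so
    \<open>R\<close> is chosen afterwards; this is harmless because \<open>sum_le\<close> holds for
    every \<open>R\<close>.\<close>
  have "\<epsilon> / (4 * pi * r) > 0" using eps r by simp
  then obtain R where R: "R \<ge> r" "\<And>z. norm z < r \<Longrightarrow> f z \<noteq> 0 \<Longrightarrow>
      norm (deriv f z / f z - (\<Sum>a\<in>zeros_in f R. of_nat (zmult f a) / (z - a))) \<le> \<epsilon> / (4 * pi * r)"
    using logderiv_approx[OF f order_zero, of "\<epsilon> / (4 * pi * r)" r] by auto
  let ?D = "\<lambda>z. indicator (ball 0 r) z * norm (z * deriv f z / f z - of_real N)"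
  have D: "integrable lborel ?D"
    "(\<integral>z. ?D z \<partial>lborel) \<le> \<epsilon> / (4 * pi * r) * pi * r ^ 3 +
      10 * pi * r\<^sup>2 * (\<Sum>a\<in>zeros_in f R. zmult f a * min (norm a / r) (r / norm a))"
    using integral_logderiv_deviation[OF f r(2) R] by (simp_all add: N_def)
  note D(2)
  also have "\<epsilon> / (4 * pi * r) * pi * r ^ 3 = \<epsilon> / 4 * r\<^sup>2 * 1"
    using r by (simp add: power2_eq_square power3_eq_cube)
  \<comment> \<open>Since the disc contains a zero, \<open>N\<close> is at least 1 and absorbs the
    error that is not proportional to it.\<close>
  also have "\<dots> \<le> \<epsilon> / 4 * r\<^sup>2 * N"
    using N eps by (intro mult_left_mono) auto
  also have "10 * pi * r\<^sup>2 * (\<Sum>a\<in>zeros_in f R. zmult f a * min (norm a / r) (r / norm a))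
      \<le> 10 * pi * r\<^sup>2 * (\<epsilon> / (40 * pi) * N)"
    unfolding N_def by (intro mult_left_mono sum_le) auto
  also have "\<epsilon> / 4 * r\<^sup>2 * N + 10 * pi * r\<^sup>2 * (\<epsilon> / (40 * pi) * N) = N * (\<epsilon> / (2 * pi) * (pi * r\<^sup>2))"
    by simp
  finally have D_le: "(\<integral>z. ?D z \<partial>lborel) \<le> N * (\<epsilon> / (2 * pi) * (pi * r\<^sup>2))" by simp
  \<comment> \<open>The radius and the integral bound are fixed before the sector is, so one radius
    serves all sectors.\<close>
  have "(\<alpha> - \<epsilon>) / (2 * pi) \<le> relative_area r (sector \<theta>\<^sub>1 \<theta>\<^sub>2) f \<and>
      relative_area r (sector \<theta>\<^sub>1 \<theta>\<^sub>2) f \<le> (\<alpha> + \<epsilon>) / (2 * pi)"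
    if \<alpha>: "\<alpha> = \<theta>\<^sub>2 - \<theta>\<^sub>1" "0 < \<alpha>" "\<alpha> \<le> 2 * pi" for \<theta>\<^sub>1 \<theta>\<^sub>2 \<alpha>
  proof -
    let ?X = "f -` sector \<theta>\<^sub>1 \<theta>\<^sub>2 \<inter> ball 0 r"
    have \<theta>: "sector \<theta>\<^sub>1 \<theta>\<^sub>2 = sector \<theta>\<^sub>1 (\<theta>\<^sub>1 + \<alpha>)" using \<alpha>(1) by simp
    have "sector \<theta>\<^sub>1 \<theta>\<^sub>2 \<in> sets borel" unfolding \<theta> by (rule sets_sector[OF \<alpha>(2,3)])
    then have X: "?X \<in> sets borel"
      using measurable_sets[OF borel_measurable_entire(1)[OF entire]] by auto
    have "N * \<bar>measure lborel ?X - \<alpha> / (2 * pi) * (pi * r\<^sup>2)\<bar> \<le> N * (\<epsilon> / (2 * pi) * (pi * r\<^sup>2))"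
      unfolding \<theta> using sector_area_deviation[OF f r(2) _ \<alpha>(2,3) D(1), of \<theta>\<^sub>1] N D_le by linarith
    then have "\<bar>measure lborel ?X - \<alpha> / (2 * pi) * (pi * r\<^sup>2)\<bar> \<le> \<epsilon> / (2 * pi) * (pi * r\<^sup>2)"
      using N by (subst (asm) mult_le_cancel_left_pos) auto
    then have "(\<alpha> - \<epsilon>) / (2 * pi) * (pi * r\<^sup>2) \<le> measure lborel ?X"
      "measure lborel ?X \<le> (\<alpha> + \<epsilon>) / (2 * pi) * (pi * r\<^sup>2)"
      unfolding diff_divide_distrib add_divide_distrib left_diff_distrib distrib_right by linarith+
    \<comment> \<open>The preimage is a Borel set, so its measures under \<open>lebesgue\<close> and
      \<open>lborel\<close> agree.\<close>
    moreover have "relative_area r (sector \<theta>\<^sub>1 \<theta>\<^sub>2) f = measure lborel ?X / (pi * r\<^sup>2)"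
      using X r by (simp add: relative_area_def measure_completion measure_lborel_disc)
    ultimately show ?thesis
      using r by (simp only: pos_le_divide_eq pos_divide_le_eq pi_gt_zero zero_less_mult_iff zero_less_power simp_thms)
  qed
  with r(1) show "\<exists>r>R\<^sub>0. \<forall>\<theta>\<^sub>1 \<theta>\<^sub>2 \<alpha>. \<alpha> = \<theta>\<^sub>2 - \<theta>\<^sub>1 \<and> 0 < \<alpha> \<and> \<alpha> \<le> 2 * pi \<longrightarrow>
    (\<alpha> - \<epsilon>) / (2 * pi) \<le> relative_area r (sector \<theta>\<^sub>1 \<theta>\<^sub>2) f \<and>
    relative_area r (sector \<theta>\<^sub>1 \<theta>\<^sub>2) f \<le> (\<alpha> + \<epsilon>) / (2 * pi)"
    by blast
qed

end
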